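(* Let $1 \le \alpha \le 2$. For every real number $c < \alpha$ and every deterministic online algorithm $\mathcal{A}$ for the GEEWE problem, there exists an instance of GEEWE in which every edge $e$ satisfies $u(e) \le \alpha\,\ell(e)$ and on which the cost of the walk produced by $\mathcal{A}$ is strictly larger than $c$ times the optimal offline cost. In other words, no algorithm for GEEWE achieves a competitive ratio better than $\alpha$ when $\alpha \le 2$ is the maximum factor between the upper and lower bound of an announced edge weight.
   Context: Graph Exploration with Edge Weight Estimates (GEEWE): An instance consists of a connected graph $G=(V,E)$, for every edge $e$ a lower bound $\ell(e)>0$ and an upper bound $u(e)\ge \ell(e)$, a start vertex $s\in V$ and a distinct end vertex $t\in V$, and (hidden) actual weights $w(e)\in[\ell(e),u(e)]$. An online algorithm knows $G$, $s$, $t$ and all bounds $\ell(e),u(e)$ in advance. An agent starts at $s$ and moves along edges; the actual weight $w(e)$ of an edge $e$ is revealed as soon as the agent visits a vertex incident to $e$. The agent must perform a walk (edges and vertices may be repeated) from $s$ to $t$ visiting every vertex of $G$; its cost is the sum of the actual weights of the traversed edges, counted with multiplicity. The optimal offline cost $\mathrm{OPT}$ is the minimum cost of such a walk when all actual weights are known. An algorithm has competitive ratio (at most) $c$ on a class of instances if on every instance of the class its cost is at most $c\cdot\mathrm{OPT}$. *)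

theory Defs
  imports Complex_Main
begin

record 'v announced =
  verts :: "'v set"
  edges :: "'v set set"
  source :: 'v
  target :: 'v
  lower :: "'v set \<Rightarrow> real"
  upper :: "'v set \<Rightarrow> real"

text \<open>Graphs are finite, undirected and simple; an edge is the two-element set of its ends.\<close>

definition connected_graph :: "'v set \<Rightarrow> 'v set set \<Rightarrow> bool" where
  "connected_graph V E \<longleftrightarrow>
     finite V \<and> (\<forall>e\<in>E. e \<subseteq> V \<and> card e = 2) \<and>
     (\<forall>x\<in>V. \<forall>y\<in>V. (x, y) \<in> {(a, b). {a, b} \<in> E}\<^sup>*)"

definition geewe_instance :: "'v announced \<Rightarrow> ('v set \<Rightarrow> real) \<Rightarrow> bool" where
  "geewe_instance P w \<longleftrightarrow>
     connected_graph (verts P) (edges P) \<and>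
     source P \<in> verts P \<and> target P \<in> verts P \<and> source P \<noteq> target P \<and>
     (\<forall>e\<in>edges P. 0 < lower P e \<and> lower P e \<le> upper P e) \<and>
     (\<forall>e\<in>edges P. lower P e \<le> w e \<and> w e \<le> upper P e)"

definition exploration_walk :: "'v announced \<Rightarrow> 'v list \<Rightarrow> bool" where
  "exploration_walk P xs \<longleftrightarrow>
     xs \<noteq> [] \<and> hd xs = source P \<and> last xs = target P \<and> set xs = verts P \<and>
     successively (\<lambda>x y. {x, y} \<in> edges P) xs"

fun walk_cost :: "('v set \<Rightarrow> real) \<Rightarrow> 'v list \<Rightarrow> real" where
  "walk_cost w (x # y # zs) = w {x, y} + walk_cost w (y # zs)"
| "walk_cost w _ = 0"

definition opt_cost :: "'v announced \<Rightarrow> ('v set \<Rightarrow> real) \<Rightarrow> real" where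
  "opt_cost P w = Inf {walk_cost w xs | xs. exploration_walk P xs}"

text \<open>Given the announced data, the vertices visited so far (in order, the last one being the
  current position) and the weights revealed so far, a deterministic strategy names the
  next vertex, or stops by answering \<^const>\<open>None\<close>.\<close>

type_synonym 'v strategy =
  "'v announced \<Rightarrow> 'v list \<Rightarrow> ('v set \<Rightarrow> real option) \<Rightarrow> 'v option"

definition revealed ::
  "'v announced \<Rightarrow> ('v set \<Rightarrow> real) \<Rightarrow> 'v list \<Rightarrow> 'v set \<Rightarrow> real option" where
  "revealed P w xs e = (if e \<in> edges P \<and> e \<inter> set xs \<noteq> {} then Some (w e) else None)"

inductive partial_run ::
  "'v strategy \<Rightarrow> 'v announced \<Rightarrow> ('v set \<Rightarrow> real) \<Rightarrow> 'v list \<Rightarrow> bool"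
  for A P w where
  start: "partial_run A P w [source P]"
| move: "partial_run A P w xs \<Longrightarrow> A P xs (revealed P w xs) = Some v \<Longrightarrow>
         partial_run A P w (xs @ [v])"

definition produces ::
  "'v strategy \<Rightarrow> 'v announced \<Rightarrow> ('v set \<Rightarrow> real) \<Rightarrow> 'v list \<Rightarrow> bool" where
  "produces A P w xs \<longleftrightarrow> partial_run A P w xs \<and> A P xs (revealed P w xs) = None"

definition geewe_algorithm :: "'v strategy \<Rightarrow> bool" where
  "geewe_algorithm A \<longleftrightarrow>
     (\<forall>P w. geewe_instance P w \<longrightarrow> (\<exists>xs. produces A P w xs \<and> exploration_walk P xs))"

lemma partial_run_nonempty: "partial_run A P w xs \<Longrightarrow> xs \<noteq> []"
  by (induction rule: partial_run.induct) auto

lemma partial_run_take_step: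
  "partial_run A P w xs \<Longrightarrow> 0 < n \<Longrightarrow> n < length xs \<Longrightarrow>
    A P (take n xs) (revealed P w (take n xs)) = Some (xs ! n)"
proof (induction rule: partial_run.induct)
  case start
  then show ?case by simp
next
  case (move xs v)
  then show ?case by (cases "n < length xs") (auto simp: nth_append)
qed

lemma partial_run_prefix_eq:
  assumes xs: "partial_run A P w xs" and ys: "partial_run A P w ys"
  shows "length xs \<le> length ys \<Longrightarrow> take (length xs) ys = xs"
  using xs
proof (induction rule: partial_run.induct)
  case start
  have "partial_run A P w ys \<Longrightarrow> take 1 ys = [source P]"
  proof (induction rule: partial_run.induct)
    case (move zs v)
    then show ?case using partial_run_nonempty[OF move.hyps(1)] by (cases zs) auto
  qed simp
  with ys show ?case by simp
next
  case (move xs v)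
  then have eq: "take (length xs) ys = xs" by simp
  have "0 < length xs" "length xs < length ys"
    using move partial_run_nonempty by auto
  with partial_run_take_step[OF ys this] eq move.hyps(2)
  have "ys ! length xs = v" by simp
  with eq \<open>length xs < length ys\<close> show ?case by (simp add: take_Suc_conv_app_nth)
qed

lemma produces_unique:
  assumes "produces A P w xs" "produces A P w ys"
  shows "xs = ys"
proof -
  have *: "xs = ys" if "produces A P w xs" "produces A P w ys" "length xs \<le> length ys" for xs ys
  proof (rule ccontr)
    assume "xs \<noteq> ys"
    have rx: "partial_run A P w xs" and ry: "partial_run A P w ys"
      and stop: "A P xs (revealed P w xs) = None"
      using that by (auto simp: produces_def)
    have eq: "take (length xs) ys = xs" using partial_run_prefix_eq[OF rx ry] that by simp
    with \<open>xs \<noteq> ys\<close> have "length xs < length ys"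
      by (metis linorder_not_le take_all)
    moreover have "0 < length xs" using partial_run_nonempty[OF rx] by simp
    ultimately show False using partial_run_take_step[OF ry, of "length xs"] eq stop by simp
  qed
  then show ?thesis using assms by (metis linorder_le_cases)
qed

lemma walk_cost_ge:
  "successively (\<lambda>x y. {x, y} \<in> E) xs \<Longrightarrow> (\<And>e. e \<in> E \<Longrightarrow> m \<le> w e) \<Longrightarrow>
    m * real (length xs - 1) \<le> walk_cost w xs"
proof (induction w xs rule: walk_cost.induct)
  case (1 w x y zs)
  then have "m * real (length (y # zs) - 1) \<le> walk_cost w (y # zs)" "m \<le> w {x, y}" by auto
  then show ?case by (simp add: algebra_simps)
qed auto

lemma walk_extend:
  assumes "(x, y) \<in> {(a, b). {a, b} \<in> E}\<^sup>*" "\<And>e. e \<in> E \<Longrightarrow> e \<subseteq> V" "x \<in> V"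
  shows "\<exists>xs. xs \<noteq> [] \<and> hd xs = x \<and> last xs = y \<and> set xs \<subseteq> V \<and>
    successively (\<lambda>a b. {a, b} \<in> E) xs"
  using assms(1)
proof (induction rule: rtrancl_induct)
  case base
  show ?case using assms(3) by (intro exI[of _ "[x]"]) auto
next
  case (step y z)
  then obtain xs where "xs \<noteq> []" "hd xs = x" "last xs = y" "set xs \<subseteq> V"
    "successively (\<lambda>a b. {a, b} \<in> E) xs" by blast
  then show ?case using step.hyps(2) assms(2)[of "{y, z}"]
    by (intro exI[of _ "xs @ [z]"]) (auto simp: successively_append_iff)
qed

lemma exploration_walk_exists:
  assumes "geewe_instance P w"
  shows "\<exists>xs. exploration_walk P xs"
proof -
  let ?V = "verts P" and ?E = "edges P"
  let ?adj = "\<lambda>a b. {a, b} \<in> ?E"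
  have fin: "finite ?V" and sub: "\<And>e. e \<in> ?E \<Longrightarrow> e \<subseteq> ?V"
    and con: "\<And>x y. x \<in> ?V \<Longrightarrow> y \<in> ?V \<Longrightarrow> (x, y) \<in> {(a, b). {a, b} \<in> ?E}\<^sup>*"
    and st: "source P \<in> ?V" "target P \<in> ?V"
    using assms by (auto simp: geewe_instance_def connected_graph_def)
  have extend: "\<exists>zs. zs \<noteq> [] \<and> hd zs = hd xs \<and> last zs = y \<and> insert y (set xs) \<subseteq> set zs \<and>
      set zs \<subseteq> ?V \<and> successively ?adj zs"
    if xs: "xs \<noteq> []" "set xs \<subseteq> ?V" "successively ?adj xs" and y: "y \<in> ?V" for xs y
  proof -
    have "last xs \<in> ?V" using xs by auto
    from walk_extend[OF con[OF this y] sub this] obtain ys where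
      ys: "ys \<noteq> []" "hd ys = last xs" "last ys = y" "set ys \<subseteq> ?V" "successively ?adj ys"
      by auto
    have zs: "butlast xs @ ys = xs @ tl ys"
      using xs(1) ys(1,2) by (metis append_butlast_last_id append_Cons append_Nil append_assoc list.collapse)
    have "successively ?adj (xs @ tl ys)"
      using xs ys by (cases ys; cases "tl ys") (auto simp: successively_append_iff)
    moreover have "last (xs @ tl ys) = y"
      using zs ys(1,3) by (metis last_appendR)
    moreover have "y \<in> set (xs @ tl ys)"
      using calculation(2) xs(1) by (metis append_is_Nil_conv last_in_set)
    moreover have "set (tl ys) \<subseteq> ?V" using ys(1,4) by (meson list.set_sel(2) subset_iff)
    ultimately show ?thesis using xs by (intro exI[of _ "xs @ tl ys"]) auto
  qed
  have "\<exists>xs. xs \<noteq> [] \<and> hd xs = source P \<and> F \<subseteq> set xs \<and> set xs \<subseteq> ?V \<and> successively ?adj xs"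
    if "F \<subseteq> ?V" for F
    using finite_subset[OF that fin] that
  proof (induction F rule: finite_induct)
    case empty
    show ?case using st by (intro exI[of _ "[source P]"]) auto
  next
    case (insert y F)
    then obtain xs where xs: "xs \<noteq> []" "hd xs = source P" "F \<subseteq> set xs" "set xs \<subseteq> ?V"
      "successively ?adj xs" by auto
    from extend[OF xs(1,4,5), of y] insert.prems obtain zs where "zs \<noteq> []" "hd zs = hd xs"
      "insert y (set xs) \<subseteq> set zs" "set zs \<subseteq> ?V" "successively ?adj zs" by auto
    then show ?case using xs by (intro exI[of _ zs]) auto
  qed
  from this[of ?V] obtain xs where xs: "xs \<noteq> []" "hd xs = source P" "set xs = ?V"
    "successively ?adj xs" by auto
  from extend[OF xs(1) _ xs(4) st(2)] xs show ?thesis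
    unfolding exploration_walk_def by fastforce
qed

text \<open>On instances, the infimum in \<^const>\<open>opt_cost\<close> is a minimum.\<close>

lemma opt_cost_attained:
  assumes inst: "geewe_instance P w"
  shows "\<exists>xs. exploration_walk P xs \<and> walk_cost w xs = opt_cost P w \<and>
    (\<forall>ys. exploration_walk P ys \<longrightarrow> walk_cost w xs \<le> walk_cost w ys)"
proof -
  let ?C = "{walk_cost w xs | xs. exploration_walk P xs}"
  have finV: "finite (verts P)" and subE: "edges P \<subseteq> Pow (verts P)"
    and pos: "\<And>e. e \<in> edges P \<Longrightarrow> 0 < w e"
    using inst by (force simp: geewe_instance_def connected_graph_def)+
  have finE: "finite (edges P)" using finV subE by (metis finite_Pow_iff finite_subset)
  define m where "m = Min (insert 1 (w ` edges P))"
  have m0: "0 < m" and mle: "\<And>e. e \<in> edges P \<Longrightarrow> m \<le> w e"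
    unfolding m_def using finE pos by auto
  obtain x0 where x0: "exploration_walk P x0" using exploration_walk_exists[OF inst] by blast
  define S where "S = {xs. exploration_walk P xs \<and> walk_cost w xs \<le> walk_cost w x0}"
  obtain N :: nat where N: "walk_cost w x0 / m < real N" using reals_Archimedean2 by blast
  have "length xs \<le> Suc N" if "xs \<in> S" for xs
  proof -
    have "m * real (length xs - 1) \<le> walk_cost w xs"
      using that mle by (intro walk_cost_ge[of "edges P"]) (auto simp: S_def exploration_walk_def)
    also have "\<dots> \<le> walk_cost w x0" using that by (simp add: S_def)
    also have "\<dots> < m * real N" using N m0 by (simp add: field_simps)
    finally show ?thesis using m0 by simp
  qed
  then have "S \<subseteq> {xs. set xs \<subseteq> verts P \<and> length xs \<le> Suc N}"
    by (auto simp: S_def exploration_walk_def)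
  then have finS: "finite S" using finite_lists_length_le[OF finV] finite_subset by blast
  have "x0 \<in> S" using x0 by (simp add: S_def)
  with finS obtain xs where xs: "xs \<in> S" "\<And>ys. ys \<in> S \<Longrightarrow> walk_cost w xs \<le> walk_cost w ys"
    using ex_is_arg_min_if_finite[OF finS, of "walk_cost w"]
    by (force simp: is_arg_min_def not_less)
  have least: "walk_cost w xs \<le> walk_cost w ys" if "exploration_walk P ys" for ys
  proof (cases "walk_cost w ys \<le> walk_cost w x0")
    case True
    then show ?thesis using xs(2)[of ys] that by (simp add: S_def)
  next
    case False
    then show ?thesis using xs(2)[OF \<open>x0 \<in> S\<close>] by simp
  qed
  moreover have "exploration_walk P xs" using xs by (simp add: S_def)
  moreover from this least have "opt_cost P w = walk_cost w xs"
    unfolding opt_cost_def by (intro cInf_eq_minimum) auto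
  ultimately show ?thesis by metis
qed

end

theory Submission
  imports Defs
begin

text \<open>The graph is complete on the numbers below \<open>2 ^ k\<close>, with lower bounds
  given by the dyadic ultrametric: \<open>2 ^ l\<close> for two vertices whose least common cluster has
  \<open>2 ^ l\<close> elements. Upper bounds are \<open>\<alpha>\<close> times as large. Minimum spanning trees have
  weight about \<open>k * 2 ^ k\<close>, so that the diameter \<open>O(2 ^ k)\<close> is negligible. An edge joining the
  two halves of a cluster is cheap only if its earlier visited end is the first vertex that completes
  a quarter of the cluster; all other edges have their maximal weight. The cheap edges link up to
  an almost optimal tour. The agent, however, has just finished the last quarter of a half when it
  has to leave that half, and returning to the cheap exit costs as much as the expensive edge,
  because scales grow only by the factor \<open>2 \<le> \<alpha> / (\<alpha> - 1)\<close>. Leaving a half early through the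
  cheap exit creates a debt, which is repaid, again because of \<open>\<alpha> \<le> 2\<close>, when the agent comes back
  for the rest.\<close>

section \<open>Dyadic clusters\<close>

definition same :: "nat \<Rightarrow> nat \<Rightarrow> nat \<Rightarrow> bool" where
  "same i x y \<longleftrightarrow> x div 2 ^ i = y div 2 ^ i"

text \<open>By \<open>same_large\<close> the \<open>LEAST\<close> always has a witness. Distinct
  points have level at least 1, and \<open>lev x x\<close> is 0.\<close>

definition lev :: "nat \<Rightarrow> nat \<Rightarrow> nat" where
  "lev x y = (LEAST i. same i x y)"

lemma same_refl [simp]: "same i x x"
  by (simp add: same_def)

lemma same_sym: "same i x y \<Longrightarrow> same i y x"
  by (simp add: same_def)

lemma same_commute: "same i x y \<longleftrightarrow> same i y x"
  by (auto simp: same_def)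

lemma same_trans: "same i x y \<Longrightarrow> same i y z \<Longrightarrow> same i x z"
  by (simp add: same_def)

lemma same_0 [simp]: "same 0 x y \<longleftrightarrow> x = y"
  by (simp add: same_def)

lemma same_mono:
  assumes "same i x y" "i \<le> j"
  shows "same j x y"
proof -
  have "(2::nat) ^ j = 2 ^ i * 2 ^ (j - i)"
    using assms(2) by (simp flip: power_add)
  then show ?thesis
    using assms(1) by (simp add: same_def div_mult2_eq)
qed

lemma same_Suc: "same (Suc i) x y \<longleftrightarrow> x div 2 ^ i div 2 = y div 2 ^ i div 2"
  by (simp add: same_def div_mult2_eq[symmetric] mult.commute)

text \<open>A cluster splits into exactly two subclusters, told apart by the parity of the quotient
  by \<open>2 ^ i\<close>; points outside the subcluster of \<open>z\<close> therefore share the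
  other one.\<close>

lemma same_two_children:
  assumes "same (Suc i) x z" "same (Suc i) y z" "\<not> same i x z" "\<not> same i y z"
  shows "same i x y"
proof -
  have half: "a = b" if "a div 2 = c div 2" "b div 2 = c div 2" "a \<noteq> c" "b \<noteq> c" for a b c :: nat
  proof -
    have "a mod 2 \<noteq> c mod 2" "b mod 2 \<noteq> c mod 2"
      using that by (metis div_mult_mod_eq)+
    then have "a mod 2 = b mod 2"
      by (metis not_mod_2_eq_0_eq_1)
    then show ?thesis
      using that by (metis div_mult_mod_eq)
  qed
  show ?thesis
    using half[OF same_Suc[THEN iffD1, OF assms(1)] same_Suc[THEN iffD1, OF assms(2)]] assms(3,4)
    unfolding same_def by metis
qed

lemma same_zero_iff: "same k u 0 \<longleftrightarrow> u < 2 ^ k"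
  by (simp add: same_def div_eq_0_iff)

lemma same_less:
  assumes "same i u v" "i \<le> k" "v < 2 ^ k"
  shows "u < 2 ^ k"
  using same_trans[OF same_mono[OF assms(1,2)], of 0] assms(3) by (simp add: same_zero_iff)

lemma finite_cluster: "finite {u. same i u x}"
proof (rule finite_subset)
  have "u < 2 ^ i * Suc (x div 2 ^ i)" if "same i u x" for u
  proof -
    have "u div 2 ^ i < Suc (x div 2 ^ i)"
      using that by (simp add: same_def)
    then show ?thesis
      by (metis div_less_iff_less_mult mult.commute zero_less_numeral zero_less_power)
  qed
  then show "{u. same i u x} \<subseteq> {..< 2 ^ i * Suc (x div 2 ^ i)}"
    by auto
qed simp

lemma sibling_exists: "\<exists>y. same (Suc i) y x \<and> \<not> same i y x"
proof -
  define q where "q = x div 2 ^ i"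
  \<comment> \<open>\<open>r\<close> is \<open>q\<close> with its lowest bit flipped, the index of
    the sibling cluster.\<close>
  define r where "r = (if even q then q + 1 else q - 1)"
  have "r div 2 = q div 2" "r \<noteq> q"
    by (auto simp: r_def elim!: evenE oddE)
  then have "same (Suc i) (r * 2 ^ i) x \<and> \<not> same i (r * 2 ^ i) x"
    unfolding same_Suc unfolding same_def q_def by simp
  then show ?thesis by blast
qed

lemma same_large: "same (max x y) x y"
proof -
  have "z div 2 ^ max x y = 0" if "z \<le> max x y" for z
    using that by (meson div_less le_less_trans less_exp)
  then show ?thesis
    by (simp add: same_def)
qed

lemma lev_le: "same i x y \<Longrightarrow> lev x y \<le> i"
  unfolding lev_def by (rule Least_le)

lemma same_lev: "same (lev x y) x y"
  unfolding lev_def using same_large by (rule LeastI)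

lemma less_lev: "\<not> same i x y \<Longrightarrow> i < lev x y"
  using same_mono[OF same_lev] not_less by blast

lemma lev_eq: "same (Suc i) x y \<Longrightarrow> \<not> same i x y \<Longrightarrow> lev x y = Suc i"
  using lev_le less_lev by (metis Suc_leI le_antisym)

lemma lev_commute: "lev x y = lev y x"
  unfolding lev_def by (simp add: same_commute)

section \<open>The adversary's weights\<close>

text \<open>Here \<^term>\<open>pos v\<close> is the time of the first visit to \<^term>\<open>v\<close>; only the order of
  these times matters.\<close>

definition completes :: "(nat \<Rightarrow> nat) \<Rightarrow> nat \<Rightarrow> nat \<Rightarrow> bool" where
  "completes pos j x \<longleftrightarrow> (\<forall>u. same j u x \<longrightarrow> pos u \<le> pos x)"

definition first_completes :: "(nat \<Rightarrow> nat) \<Rightarrow> nat \<Rightarrow> nat \<Rightarrow> nat \<Rightarrow> bool" where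
  "first_completes pos j i x \<longleftrightarrow>
     completes pos j x \<and> (\<forall>u. same i u x \<and> completes pos j u \<longrightarrow> pos x \<le> pos u)"

text \<open>The earlier visited end decides, since the weight must be fixed when that end is
  reached. The guard \<open>2 \<le> lev x y\<close> excludes truncated subtraction: clusters of
  level 1 have no quarters, so their edge is always expensive.\<close>

definition pair_weight :: "real \<Rightarrow> (nat \<Rightarrow> nat) \<Rightarrow> nat \<Rightarrow> nat \<Rightarrow> real" where
  "pair_weight \<alpha> pos x y =
     (if 2 \<le> lev x y \<and>
         first_completes pos (lev x y - 2) (lev x y) (if pos x < pos y then x else y)
      then 2 ^ lev x y else \<alpha> * 2 ^ lev x y)"

definition weight :: "real \<Rightarrow> (nat \<Rightarrow> nat) \<Rightarrow> nat set \<Rightarrow> real" where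
  "weight \<alpha> pos e = pair_weight \<alpha> pos (Min e) (Max e)"

text \<open>\<open>S\<close> stands for the visited vertices, while the order of later visits is
  still open. The deciding end lies in \<open>S\<close>, and whether it is the first to complete a
  quarter depends only on comparisons with members of \<open>S\<close>, on which both orders
  agree.\<close>

lemma pair_weight_online:
  assumes S: "x \<in> S" and agree: "\<And>u. u \<in> S \<Longrightarrow> pos u = pos' u"
    and later: "\<And>u z. u \<in> S \<Longrightarrow> z \<notin> S \<Longrightarrow> pos u < pos z \<and> pos u < pos' z"
  shows "pair_weight \<alpha> pos x y = pair_weight \<alpha> pos' x y"
    and "pair_weight \<alpha> pos y x = pair_weight \<alpha> pos' y x"
proof -
  have le: "pos z \<le> pos u \<longleftrightarrow> pos' z \<le> pos' u" if "u \<in> S" for u z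
    using agree[OF that] agree[of z] later[OF that, of z] by (cases "z \<in> S") auto
  have c: "completes pos j u \<longleftrightarrow> completes pos' j u" if "u \<in> S" for j u
    using le[OF that] by (simp add: completes_def)
  have f: "first_completes pos j i u \<longleftrightarrow> first_completes pos' j i u" if u: "u \<in> S" for j i u
  proof -
    have "(completes pos j z \<longrightarrow> pos u \<le> pos z) \<longleftrightarrow> (completes pos' j z \<longrightarrow> pos' u \<le> pos' z)" for z
      using c[of z] agree[OF u] agree[of z] later[OF u, of z] by (cases "z \<in> S") auto
    then show ?thesis
      unfolding first_completes_def using c[OF u] by blast
  qed
  have e: "(if pos x < pos y then x else y) = (if pos' x < pos' y then x else y)"
    "(if pos y < pos x then y else x) = (if pos' y < pos' x then y else x)"
    using S agree[of x] agree[of y] later[OF S, of y] by (cases "y \<in> S"; simp)+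
  have "(if pos x < pos y then x else y) \<in> S" "(if pos y < pos x then y else x) \<in> S"
    using S later[OF S, of y] by (cases "y \<in> S"; simp)+
  note f[OF this(1)] f[OF this(2)]
  then show "pair_weight \<alpha> pos x y = pair_weight \<alpha> pos' x y"
    "pair_weight \<alpha> pos y x = pair_weight \<alpha> pos' y x"
    by (simp_all only: pair_weight_def e[symmetric])
qed

lemma weight_online:
  assumes "x \<in> S" and "\<And>u. u \<in> S \<Longrightarrow> pos u = pos' u"
    and "\<And>u z. u \<in> S \<Longrightarrow> z \<notin> S \<Longrightarrow> pos u < pos z \<and> pos u < pos' z"
  shows "weight \<alpha> pos {x, y} = weight \<alpha> pos' {x, y}"
proof (cases "x \<le> y")
  case True
  then have "Min {x, y} = x" "Max {x, y} = y" by auto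
  then show ?thesis
    unfolding weight_def using pair_weight_online(1)[OF assms] by simp
next
  case False
  then have "Min {x, y} = y" "Max {x, y} = x" by auto
  then show ?thesis
    unfolding weight_def using pair_weight_online(2)[OF assms] by simp
qed

section \<open>Costs of concatenated and reversed walks, and crossing edges\<close>

lemma walk_cost_append:
  "walk_cost w (xs @ p # ys) = walk_cost w (xs @ [p]) + walk_cost w (p # ys)"
proof (induction xs)
  case Nil
  then show ?case by (cases ys) auto
next
  case (Cons a xs)
  then show ?case by (cases xs) auto
qed

lemma walk_cost_join:
  assumes "ps \<noteq> []" "qs \<noteq> []"
  shows "walk_cost w (ps @ qs) = walk_cost w ps + w {last ps, hd qs} + walk_cost w qs"
proof -
  obtain q qs' where qs: "qs = q # qs'" using assms(2) by (cases qs) auto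
  obtain ps' p where ps: "ps = ps' @ [p]" using assms(1) by (cases ps rule: rev_cases) auto
  show ?thesis
    using walk_cost_append[of w ps q qs'] walk_cost_append[of w ps' p "[q]"] by (simp add: ps qs)
qed

lemma walk_cost_rev: "walk_cost w (rev xs) = walk_cost w xs"
proof (induction w xs rule: walk_cost.induct)
  case (1 w x y zs)
  have "walk_cost w (rev (x # y # zs)) = walk_cost w (rev zs @ y # [x])" by simp
  also have "\<dots> = walk_cost w (rev zs @ [y]) + walk_cost w [y, x]"
    by (rule walk_cost_append)
  also have "\<dots> = walk_cost w (y # zs) + w {x, y}"
    using 1 by (simp add: insert_commute)
  finally show ?case by simp
qed auto

lemma walk_cost_nonneg: "(\<And>e. 0 \<le> w e) \<Longrightarrow> 0 \<le> walk_cost w xs"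
  by (induction w xs rule: walk_cost.induct) auto

text \<open>Locates an edge by which a walk leaves a cluster. The pieces \<open>ys\<close> and
  \<open>zs\<close> are kept because their costs are needed as well.\<close>

lemma walk_crossing:
  assumes "xs \<noteq> []" "Q (hd xs)" "\<not> Q (last xs)"
  obtains ys p q zs where "xs = ys @ p # q # zs" "Q p" "\<not> Q q"
proof -
  have "\<exists>ys p q zs. xs = ys @ p # q # zs \<and> Q p \<and> \<not> Q q"
    using assms
  proof (induction xs)
    case (Cons a xs)
    show ?case
    proof (cases "xs = [] \<or> \<not> Q (hd xs)")
      case True
      then show ?thesis
        using Cons.prems by (intro exI[of _ "[]"]) (auto, metis list.collapse)
    next
      case False
      then obtain ys p q zs where "xs = ys @ p # q # zs" "Q p" "\<not> Q q"
        using Cons by (auto split: if_splits)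
      then show ?thesis
        by (intro exI[of _ "a # ys"]) auto
    qed
  qed simp
  then show thesis using that by blast
qed

section \<open>Distances forced by the adversary\<close>

locale adversary =
  fixes \<alpha> :: real and pos :: "nat \<Rightarrow> nat"
  assumes alpha: "1 \<le> \<alpha>" "\<alpha> \<le> 2" and inj_pos: "inj pos"
begin

abbreviation "w \<equiv> weight \<alpha> pos"

lemma pos_eq_iff: "pos x = pos y \<longleftrightarrow> x = y"
  using inj_pos by (auto dest: injD)

lemma pos_less: "pos x \<le> pos y \<Longrightarrow> x \<noteq> y \<Longrightarrow> pos x < pos y"
  using pos_eq_iff by (simp add: order.strict_iff_order)

lemma pair_weight_commute: "pair_weight \<alpha> pos x y = pair_weight \<alpha> pos y x"
proof -
  have "(if pos x < pos y then x else y) = (if pos y < pos x then y else x)"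
    using pos_eq_iff[of x y] by auto
  then show ?thesis
    by (simp add: pair_weight_def lev_commute[of x y])
qed

lemma w_pair: "w {x, y} = pair_weight \<alpha> pos x y"
  using pair_weight_commute[of x y]
  by (cases "x \<le> y") (simp_all add: weight_def max_def min_def)

lemma w_bounds: "2 ^ lev x y \<le> w {x, y}" "w {x, y} \<le> \<alpha> * 2 ^ lev x y"
  using alpha by (auto simp: w_pair pair_weight_def)

lemma w_nonneg: "0 \<le> w e"
  using alpha by (auto simp: weight_def pair_weight_def)

lemma cost_nonneg: "0 \<le> walk_cost w xs"
  by (rule walk_cost_nonneg) (rule w_nonneg)

lemma w_ge:
  assumes "\<not> same i x y"
  shows "2 ^ Suc i \<le> w {x, y}"
proof -
  have "(2::real) ^ Suc i \<le> 2 ^ lev x y"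
    using less_lev[OF assms] by (intro power_increasing) auto
  then show ?thesis
    using w_bounds(1)[of x y] by linarith
qed

text \<open>At level \<open>Suc i\<close> the quarters have level \<open>Suc i - 2\<close>, so a
  cheap edge exists only for \<open>i = Suc j\<close>. The lower bounds below branch on these
  cases.\<close>

lemma w_siblings:
  assumes "same (Suc i) x y" "\<not> same i x y"
  obtains "w {x, y} = \<alpha> * 2 ^ Suc i"
  | j where "i = Suc j" "first_completes pos j (Suc i) x" "pos x < pos y"
  | j where "i = Suc j" "first_completes pos j (Suc i) y" "pos y < pos x"
proof -
  have "x \<noteq> y" using assms(2) by auto
  then have "pos x < pos y \<or> pos y < pos x"
    using pos_eq_iff by (meson linorder_neqE_nat)
  moreover have "w {x, y} = \<alpha> * 2 ^ Suc i \<or>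
    (\<exists>j. i = Suc j \<and> first_completes pos j (Suc i) (if pos x < pos y then x else y))"
    by (cases i) (auto simp: w_pair pair_weight_def lev_eq[OF assms])
  ultimately show thesis
    using that by (auto split: if_splits)
qed

lemma first_completes_shrink:
  "first_completes pos j i x \<Longrightarrow> i' \<le> i \<Longrightarrow> first_completes pos j i' x"
  unfolding first_completes_def using same_mono by blast

lemma last_exists: "\<exists>l. same i l x \<and> completes pos i l"
proof -
  define S where "S = {u. same i u x}"
  have S: "finite S" "x \<in> S"
    by (simp_all add: S_def finite_cluster)
  then have "Max (pos ` S) \<in> pos ` S"
    by (intro Max_in) auto
  then obtain l where l: "l \<in> S" "pos l = Max (pos ` S)"
    by auto
  have "pos u \<le> pos l" if "u \<in> S" for u
    unfolding l(2) using S(1) that by simp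
  then show ?thesis
    using l(1) same_trans unfolding S_def completes_def by blast
qed

lemma completes_unique:
  "completes pos i x \<Longrightarrow> completes pos i y \<Longrightarrow> same i x y \<Longrightarrow> x = y"
  unfolding completes_def using pos_eq_iff same_sym by (metis order_antisym)

lemma first_completes_unique:
  "first_completes pos j i x \<Longrightarrow> first_completes pos j i y \<Longrightarrow> same i x y \<Longrightarrow> x = y"
  unfolding first_completes_def using pos_eq_iff same_sym by (metis order_antisym)

text \<open>The other half of the cluster is completed by a different vertex \<open>u\<close>;
  \<open>p\<close> precedes \<open>u\<close>, which is not later than \<open>x\<close>.\<close>

lemma first_completes_before_last:
  assumes p: "first_completes pos j (Suc j) p" and x: "completes pos (Suc j) x" "same (Suc j) p x"
  shows "pos p < pos x"
proof -
  obtain z where z: "same (Suc j) z p" "\<not> same j z p"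
    using sibling_exists by blast
  obtain u where u: "same j u z" "completes pos j u"
    using last_exists by blast
  have up: "same (Suc j) u p"
    using same_mono[OF u(1)] z(1) same_trans by (metis le_add2 plus_1_eq_Suc)
  have "u \<noteq> p" using u z same_sym by blast
  moreover have "pos p \<le> pos u"
    using p u up by (simp add: first_completes_def)
  moreover have "pos u \<le> pos x"
    using x same_trans[OF up x(2)] by (simp add: completes_def)
  ultimately show ?thesis
    using pos_less[of p u] by simp
qed

text \<open>A cheap edge used on the way leads to or from the corresponding vertex of one of the two
  subclusters, so that the induction hypothesis pays for the rest of the walk.\<close>

lemma detour:
  assumes "first_completes pos i (Suc i) x" "same (Suc i) x v" "pos x < pos v"
    and "xs \<noteq> []" "hd xs = x" "last xs = v"
  shows "(\<alpha> - 1) * 2 ^ (i + 2) \<le> walk_cost w xs"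
  using assms
proof (induction i arbitrary: x v xs)
  case (0 x v xs)
  then have "same 0 (hd xs) x" "\<not> same 0 (last xs) x" by auto
  then obtain ys p q zs where xs: "xs = ys @ p # q # zs" and p: "same 0 p x" and q: "\<not> same 0 q x"
    by (rule walk_crossing[OF 0(4), where Q = "\<lambda>u. same 0 u x"])
  have cost: "w {p, q} \<le> walk_cost w xs"
    using cost_nonneg[of "ys @ [p]"] cost_nonneg[of "q # zs"]
    unfolding xs walk_cost_append[of w ys p "q # zs"] by simp
  show ?case
  proof (cases "same 1 p q")
    case True
    then have s: "same (Suc 0) p q" "\<not> same 0 p q"
      using p q by auto
    have "w {p, q} = \<alpha> * 2"
      by (rule w_siblings[OF s]) simp_all
    then show ?thesis using cost alpha by simp
  next
    case False
    from w_ge[OF this] cost alpha show ?thesis by simp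
  qed
next
  case (Suc i x v xs)
  let ?i = "Suc i"
  have nsame: "\<not> same ?i v x"
    using Suc.prems(1,3) by (auto simp: first_completes_def completes_def)
  then have "same ?i (hd xs) x" "\<not> same ?i (last xs) x"
    using Suc.prems(5,6) by auto
  then obtain ys p q zs where xs: "xs = ys @ p # q # zs" and p: "same ?i p x" and q: "\<not> same ?i q x"
    by (rule walk_crossing[OF Suc.prems(4), where Q = "\<lambda>u. same ?i u x"])
  have cost: "walk_cost w xs = walk_cost w (ys @ [p]) + w {p, q} + walk_cost w (q # zs)"
    unfolding xs walk_cost_append[of w ys p "q # zs"] by simp
  have nn: "0 \<le> walk_cost w (ys @ [p])" "0 \<le> walk_cost w (q # zs)"
    by (rule cost_nonneg)+
  have npq: "\<not> same ?i p q"
    using p q same_sym same_trans by blast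
  have pw: "(2::real) ^ (?i + 2) = 2 * 2 ^ Suc ?i" "(2::real) ^ (i + 2) = 2 ^ Suc ?i"
    by simp_all
  \<comment> \<open>One expensive edge between the halves pays for the whole bound; this is where
    \<open>\<alpha> \<le> 2\<close> enters.\<close>
  have half: "(\<alpha> - 1) * 2 ^ (?i + 2) \<le> \<alpha> * 2 ^ Suc ?i"
    unfolding pw using alpha by simp
  \<comment> \<open>A cheap edge and a detour one scale below add up to an expensive edge.\<close>
  have split: "(\<alpha> - 1) * 2 ^ Suc ?i + 2 ^ Suc ?i = \<alpha> * 2 ^ Suc ?i"
    by (simp add: algebra_simps)
  show ?case
  proof (cases "same (Suc ?i) p q")
    case False
    have "(\<alpha> - 1) * 2 ^ (?i + 2) \<le> 1 * 2 ^ (?i + 2)"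
      using alpha by (intro mult_right_mono) auto
    also have "\<dots> \<le> w {p, q}"
      using w_ge[OF False] by simp
    also have "\<dots> \<le> walk_cost w xs"
      using cost nn by linarith
    finally show ?thesis .
  next
    case True
    from True npq show ?thesis
    proof (cases rule: w_siblings)
      case 1
      then show ?thesis using cost nn half by linarith
    next
      case (2 j)
      then have fp: "first_completes pos i ?i p"
        using first_completes_shrink[of i "Suc ?i" _ ?i] by simp
      have x: "completes pos ?i x"
        using Suc.prems(1) by (simp add: first_completes_def)
      \<comment> \<open>The way from \<open>x\<close> to the cheap exit \<open>p\<close> is read
        backwards, so that it starts at a first completing vertex as the induction hypothesis
        requires.\<close>
      have "hd (rev (ys @ [p])) = p" "last (rev (ys @ [p])) = x"
        using xs Suc.prems(5) by (cases ys; simp)+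
      then have "(\<alpha> - 1) * 2 ^ (i + 2) \<le> walk_cost w (rev (ys @ [p]))"
        using Suc.IH[OF fp p first_completes_before_last[OF fp x p], of "rev (ys @ [p])"] by simp
      then have "(\<alpha> - 1) * 2 ^ Suc ?i \<le> walk_cost w (ys @ [p])"
        unfolding walk_cost_rev pw .
      then show ?thesis
        using cost nn w_ge[OF npq] half split by linarith
    next
      case (3 j)
      then have fq: "first_completes pos i ?i q"
        using first_completes_shrink[of i "Suc ?i" _ ?i] by simp
      have "same (Suc ?i) q x"
        using True p same_mono[OF p, of "Suc ?i"] same_sym same_trans by (meson le_SucI order_refl)
      then have qv: "same ?i q v"
        using same_two_children[of ?i q x v] q nsame Suc.prems(2) same_sym by blast
      \<comment> \<open>\<open>x\<close> is the last vertex of its subcluster, which contains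
        \<open>p\<close>; hence \<open>q\<close>, being earlier than \<open>p\<close>, precedes
        \<open>v\<close>.\<close>
      have "pos p \<le> pos x"
        using Suc.prems(1) p by (simp add: first_completes_def completes_def)
      then have "pos q < pos v"
        using 3 Suc.prems(3) by simp
      moreover have "last (q # zs) = v"
        using xs Suc.prems(6) by simp
      ultimately have "(\<alpha> - 1) * 2 ^ (i + 2) \<le> walk_cost w (q # zs)"
        using Suc.IH[OF fq qv, of "q # zs"] by simp
      then have "(\<alpha> - 1) * 2 ^ Suc ?i \<le> walk_cost w (q # zs)"
        unfolding pw .
      then show ?thesis
        using cost nn w_ge[OF npq] half split by linarith
    qed
  qed
qed

section \<open>The offline tour\<close>

text \<open>The cheap tour of a cluster runs backwards through the subcluster completed first, from its
  last vertex, and then forwards through the other one.\<close>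

lemma cheap_tour:
  "\<exists>ps. ps \<noteq> [] \<and> set ps = {u. same (Suc i) u x} \<and> successively (\<noteq>) ps \<and>
     first_completes pos i (Suc i) (hd ps) \<and> completes pos (Suc i) (last ps) \<and>
     walk_cost w ps \<le> (real i + \<alpha>) * 2 ^ Suc i"
proof (induction i arbitrary: x)
  case (0 x)
  obtain y where y: "same (Suc 0) y x" "\<not> same 0 y x"
    using sibling_exists by blast
  have pair: "u = x \<or> u = y" if "same (Suc 0) u x" for u
    using same_two_children[OF that y(1)] y(2) by auto
  have tour: "\<exists>ps. ps \<noteq> [] \<and> set ps = {u. same (Suc 0) u x} \<and> successively (\<noteq>) ps \<and>
      first_completes pos 0 (Suc 0) (hd ps) \<and> completes pos (Suc 0) (last ps) \<and>
      walk_cost w ps \<le> (real 0 + \<alpha>) * 2 ^ Suc 0"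
    if ab: "{a, b} = {u. same (Suc 0) u x}" "pos a < pos b" for a b
  proof (intro exI[of _ "[a, b]"] conjI)
    have cl: "pos a \<le> pos u \<and> pos u \<le> pos b"
      if "same (Suc 0) u a \<or> same (Suc 0) u b" for u
    proof -
      have "u \<in> {a, b}"
        unfolding ab(1) using that ab(1) same_trans by blast
      then show ?thesis using ab(2) by auto
    qed
    show "first_completes pos 0 (Suc 0) (hd [a, b])" "completes pos (Suc 0) (last [a, b])"
      using cl by (auto simp: first_completes_def completes_def)
    have "same (Suc 0) a b"
      using ab(1) same_sym same_trans by blast
    then have "lev a b = Suc 0"
      using ab(2) by (intro lev_eq) auto
    then show "walk_cost w [a, b] \<le> (real 0 + \<alpha>) * 2 ^ Suc 0"
      using w_bounds(2)[of a b] by simp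
  qed (use ab in auto)
  have eq: "{x, y} = {u. same (Suc 0) u x}"
    using pair y(1) by auto
  have "x \<noteq> y" using y(2) by auto
  then consider "pos x < pos y" | "pos y < pos x"
    using pos_less by (metis linorder_le_cases)
  then show ?case
    using tour[of x y] tour[of y x] eq by (cases; simp add: insert_commute)
next
  case (Suc i x)
  let ?i = "Suc i"
  obtain y where y: "same (Suc ?i) y x" "\<not> same ?i y x"
    using sibling_exists by blast
  \<comment> \<open>The subcluster of \<open>a\<close> is the one completed first. Both
    \<open>a\<close> and \<open>b\<close> are arbitrary because \<open>x\<close> may lie in either
    subcluster.\<close>
  have tour: "\<exists>ps. ps \<noteq> [] \<and> set ps = {u. same (Suc ?i) u x} \<and> successively (\<noteq>) ps \<and>
      first_completes pos ?i (Suc ?i) (hd ps) \<and> completes pos (Suc ?i) (last ps) \<and>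
      walk_cost w ps \<le> (real ?i + \<alpha>) * 2 ^ Suc ?i"
    if ab: "same (Suc ?i) a b" "\<not> same ?i a b" "same (Suc ?i) a x"
    and ps: "ps \<noteq> []" "set ps = {u. same ?i u a}" "successively (\<noteq>) ps"
      "first_completes pos i ?i (hd ps)" "completes pos ?i (last ps)"
      "walk_cost w ps \<le> (real i + \<alpha>) * 2 ^ ?i"
    and qs: "qs \<noteq> []" "set qs = {u. same ?i u b}" "successively (\<noteq>) qs"
      "first_completes pos i ?i (hd qs)" "completes pos ?i (last qs)"
      "walk_cost w qs \<le> (real i + \<alpha>) * 2 ^ ?i"
    and less: "pos (last ps) < pos (last qs)" for a b ps qs
  proof (intro exI[of _ "rev ps @ qs"] conjI)
    have mem: "same ?i (hd ps) a" "same ?i (last ps) a" "same ?i (hd qs) b" "same ?i (last qs) b"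
      using ps(1,2) qs(1,2) hd_in_set last_in_set by blast+
    have split: "same ?i u a \<or> same ?i u b" if "same (Suc ?i) u x" for u
    proof -
      have "same (Suc ?i) u b" "same (Suc ?i) u a"
        using that ab(1,3) same_sym same_trans by blast+
      then show ?thesis
        using same_two_children[of ?i u b a] ab(1,2) by blast
    qed
    have up: "same (Suc ?i) u x" if "same ?i u a \<or> same ?i u b" for u
      using that same_mono[of ?i u _ "Suc ?i"] ab(1,3) same_sym same_trans
      by (meson le_SucI order_refl)
    show "set (rev ps @ qs) = {u. same (Suc ?i) u x}"
      using split up ps(2) qs(2) by auto
    have ends: "hd (rev ps @ qs) = last ps" "last (rev ps @ qs) = last qs"
      using ps(1) qs(1) by (simp_all add: hd_rev)
    have ne: "u \<noteq> v" if "same ?i u a" "same ?i v b" for u v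
      using that ab(2) same_sym same_trans by blast
    show "successively (\<noteq>) (rev ps @ qs)"
      using ps(1,3) qs(3) ne[OF mem(1,3)]
      by (auto simp: successively_append_iff last_rev eq_commute)
    have last_split: "u = last ps \<or> u = last qs"
      if "completes pos ?i u" "same (Suc ?i) u x" for u
      using split[OF that(2)] completes_unique[OF that(1)] ps(5) qs(5) mem(2,4) same_sym same_trans
      by meson
    have near: "same (Suc ?i) u x" if "same (Suc ?i) u v" "v \<in> {last ps, last qs, hd ps, hd qs}"
      for u v
      using that up mem same_trans by blast
    show "first_completes pos ?i (Suc ?i) (hd (rev ps @ qs))"
      unfolding ends first_completes_def
      using ps(5) less last_split near by (metis insertCI less_imp_le order_refl)
    show "completes pos (Suc ?i) (last (rev ps @ qs))"
      unfolding ends completes_def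
    proof (intro allI impI)
      fix u assume "same (Suc ?i) u (last qs)"
      then have "same ?i u (last ps) \<or> same ?i u (last qs)"
        using near[of u "last qs"] split mem same_sym same_trans by blast
      then have "pos u \<le> pos (last ps) \<or> pos u \<le> pos (last qs)"
        using ps(5) qs(5) by (auto simp: completes_def)
      then show "pos u \<le> pos (last qs)"
        using less by auto
    qed
    have first: "pos (hd ps) \<le> pos u \<or> pos (hd qs) \<le> pos u"
      if "completes pos i u" "same (Suc ?i) u x" for u
      using split[OF that(2)] ps(4) qs(4) that(1) mem same_sym same_trans
      unfolding first_completes_def by meson
    \<comment> \<open>\<open>hd ps\<close> and \<open>hd qs\<close> are the first to complete a
      quarter in their own halves, so the earlier of them is the first in the whole cluster. This
      makes the linking edge cheap.\<close>
    have cheap: "first_completes pos i (Suc ?i) u"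
      if u: "u = hd ps \<and> pos (hd ps) \<le> pos (hd qs) \<or> u = hd qs \<and> pos (hd qs) \<le> pos (hd ps)" for u
      unfolding first_completes_def
    proof (intro conjI allI impI)
      show "completes pos i u"
        using u ps(4) qs(4) by (auto simp: first_completes_def)
      show "pos u \<le> pos v" if "same (Suc ?i) v u \<and> completes pos i v" for v
        using first[of v] near[of v u] that u by auto
    qed
    have link: "same (Suc ?i) (hd ps) (hd qs)" "\<not> same ?i (hd ps) (hd qs)"
    proof -
      have "same (Suc ?i) (hd ps) x" "same (Suc ?i) (hd qs) x"
        using up mem(1,3) by simp_all
      then show "same (Suc ?i) (hd ps) (hd qs)"
        using same_sym same_trans by blast
      show "\<not> same ?i (hd ps) (hd qs)"
      proof
        assume "same ?i (hd ps) (hd qs)"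
        then show False
          using same_trans[OF same_trans[OF same_sym[OF mem(1)]] mem(3)] ab(2) by simp
      qed
    qed
    have "w {hd ps, hd qs} = 2 ^ Suc ?i"
      using cheap[of "if pos (hd ps) < pos (hd qs) then hd ps else hd qs"]
      by (simp add: w_pair pair_weight_def lev_eq[OF link])
    then have "walk_cost w (rev ps @ qs) = walk_cost w ps + 2 ^ Suc ?i + walk_cost w qs"
      using walk_cost_join[of "rev ps" qs w] ps(1) qs(1) by (simp add: last_rev walk_cost_rev)
    \<comment> \<open>Two tours and one link: twice the bound at \<open>i\<close> plus
      \<open>2 ^ Suc ?i\<close> is the bound at \<open>?i\<close>.\<close>
    then show "walk_cost w (rev ps @ qs) \<le> (real ?i + \<alpha>) * 2 ^ Suc ?i"
      using ps(6) qs(6) by (simp add: algebra_simps)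
  qed (use ps(1) in simp)
  obtain ps where ps: "ps \<noteq> []" "set ps = {u. same ?i u x}" "successively (\<noteq>) ps"
      "first_completes pos i ?i (hd ps)" "completes pos ?i (last ps)"
      "walk_cost w ps \<le> (real i + \<alpha>) * 2 ^ ?i"
    using Suc.IH[of x] by blast
  obtain qs where qs: "qs \<noteq> []" "set qs = {u. same ?i u y}" "successively (\<noteq>) qs"
      "first_completes pos i ?i (hd qs)" "completes pos ?i (last qs)"
      "walk_cost w qs \<le> (real i + \<alpha>) * 2 ^ ?i"
    using Suc.IH[of y] by blast
  have xy: "same (Suc ?i) x y" "\<not> same ?i x y"
    using y by (simp_all add: same_commute)
  have "last ps \<noteq> last qs"
  proof -
    have "same ?i (last ps) x" "same ?i (last qs) y"
      using last_in_set[OF ps(1)] last_in_set[OF qs(1)] ps(2) qs(2) by simp_all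
    then show ?thesis
      using same_trans[OF same_sym] xy(2) by metis
  qed
  then consider "pos (last ps) < pos (last qs)" | "pos (last qs) < pos (last ps)"
    using pos_less by (metis linorder_le_cases)
  then show ?case
  proof cases
    case 1
    show ?thesis by (rule tour[OF xy same_refl ps qs 1])
  next
    case 2
    show ?thesis by (rule tour[OF y(1,2,1) qs ps 2])
  qed
qed

section \<open>The potential of the agent\<close>

lemma cost_ge:
  assumes "xs \<noteq> []" "hd xs = a" "last xs = v" "\<not> same m a v"
  shows "2 ^ Suc m \<le> walk_cost w xs"
proof -
  have "\<not> same m (hd xs) v" "\<not> \<not> same m (last xs) v"
    using assms by auto
  then obtain ys p q zs where xs: "xs = ys @ p # q # zs" and "\<not> same m p v" "\<not> \<not> same m q v"
    by (rule walk_crossing[OF assms(1), where Q = "\<lambda>u. \<not> same m u v"])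
  then have "\<not> same m p q"
    using same_trans by blast
  from w_ge[OF this] show ?thesis
    using cost_nonneg[of "ys @ [p]"] cost_nonneg[of "q # zs"]
    unfolding xs walk_cost_append[of w ys p "q # zs"] by simp
qed

text \<open>The walk consists of the moves between two consecutive first visits, so every vertex on
  it before \<open>v\<close> is old. A crossing edge above level \<open>Suc m\<close> costs at least
  \<open>2 ^ (m + 2)\<close>, which is enough because \<open>\<alpha> \<le> 2\<close>; any other one
  joins two siblings.\<close>

lemma enter_crossing:
  assumes walk: "xs \<noteq> []" "hd xs = a" "last xs = v" "\<forall>u\<in>set (butlast xs). pos u < pos v"
    and a: "\<not> same m a v"
  obtains "\<alpha> * 2 ^ Suc m \<le> walk_cost w xs"
  | ys p q zs where "xs = ys @ p # q # zs" "same (Suc m) p q" "\<not> same m p q" "same m q v"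
    "pos p < pos v"
    "walk_cost w xs = walk_cost w (ys @ [p]) + w {p, q} + walk_cost w (q # zs)"
proof -
  have "\<not> same m (hd xs) v" "\<not> \<not> same m (last xs) v"
    using assms by auto
  then obtain ys p q zs where xs: "xs = ys @ p # q # zs" and p: "\<not> same m p v" and "\<not> \<not> same m q v"
    by (rule walk_crossing[OF walk(1), where Q = "\<lambda>u. \<not> same m u v"])
  then have q: "same m q v" and pq: "\<not> same m p q"
    using same_trans by blast+
  have cost: "walk_cost w xs = walk_cost w (ys @ [p]) + w {p, q} + walk_cost w (q # zs)"
    unfolding xs walk_cost_append[of w ys p "q # zs"] by simp
  have "pos p < pos v"
    using walk(4) by (simp add: xs butlast_append)
  show thesis
  proof (cases "same (Suc m) p q")
    case True
    show thesis by (rule that(2)[OF xs True pq q \<open>pos p < pos v\<close> cost])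
  next
    case False
    have "\<alpha> * 2 ^ Suc m \<le> 2 ^ Suc (Suc m)"
      using alpha by simp
    then show thesis
      using that(1) w_ge[OF False] cost cost_nonneg[of "ys @ [p]"] cost_nonneg[of "q # zs"]
      by linarith
  qed
qed

lemma detour_split:
  assumes "(\<alpha> - 1) * 2 ^ (j + 2) \<le> c" "2 ^ Suc (Suc j) \<le> d"
  shows "\<alpha> * 2 ^ Suc (Suc j) \<le> c + d"
proof -
  have "(\<alpha> - 1) * 2 ^ (j + 2) + 2 ^ Suc (Suc j) = \<alpha> * 2 ^ Suc (Suc j)"
    by (simp add: algebra_simps)
  then show ?thesis using assms by linarith
qed

text \<open>A cheap crossing would start at the vertex \<open>p\<close> that first completed half of
  the old cluster. By \<open>complete\<close> that cluster is then finished, its last vertex is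
  \<open>a\<close>, and the way from \<open>a\<close> to \<open>p\<close> is a
  \<open>detour\<close>.\<close>

lemma cost_enter_new:
  assumes walk: "xs \<noteq> []" "hd xs = a" "last xs = v" "\<forall>u\<in>set (butlast xs). pos u < pos v"
    and latest: "\<forall>u. pos u < pos v \<longrightarrow> pos u \<le> pos a"
    and sib: "same (Suc m) a v" "\<not> same m a v" and new: "\<forall>z. same m z v \<longrightarrow> pos v \<le> pos z"
    and complete: "\<And>j e z. m = Suc j \<Longrightarrow> first_completes pos j m e \<Longrightarrow> same m e a \<Longrightarrow> pos e < pos v \<Longrightarrow>
      same m z a \<Longrightarrow> pos z < pos v"
  shows "\<alpha> * 2 ^ Suc m \<le> walk_cost w xs"
  using walk sib(2)
proof (cases rule: enter_crossing)
  case (2 ys p q zs)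
  have cost: "walk_cost w (ys @ [p]) + w {p, q} \<le> walk_cost w xs"
    "0 \<le> walk_cost w (ys @ [p])"
    using 2(6) cost_nonneg by simp_all
  have "pos v \<le> pos q" using new 2(4) by blast
  with 2(5) have "pos p < pos q" by simp
  from 2(2,3) show ?thesis
  proof (cases rule: w_siblings)
    case 1
    then show ?thesis using cost by linarith
  next
    case (2 j)
    have fp: "first_completes pos j (Suc j) p"
      using first_completes_shrink[OF 2(2)] 2(1) by simp
    have qv: "same (Suc m) q v" "same (Suc m) p q"
      using same_mono[OF \<open>same m q v\<close>] \<open>same (Suc m) p q\<close> by simp_all
    have pa: "same m p a"
    proof (rule same_two_children)
      show "same (Suc m) p v" using qv same_trans by blast
      show "\<not> same m p v"
        using \<open>\<not> same m p q\<close> \<open>same m q v\<close> same_sym same_trans by blast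
    qed (use sib in auto)
    have all: "pos z < pos v" if "same m z a" for z
      using complete[of j p z] fp pa \<open>pos p < pos v\<close> that 2(1) by blast
    then have a: "completes pos (Suc j) a"
      using latest 2(1) by (simp add: completes_def)
    have pa': "same (Suc j) p a" using pa 2(1) by simp
    have "hd (rev (ys @ [p])) = p" "last (rev (ys @ [p])) = a"
      using \<open>xs = ys @ p # q # zs\<close> walk(2) by (cases ys; simp)+
    then have "(\<alpha> - 1) * 2 ^ (j + 2) \<le> walk_cost w (rev (ys @ [p]))"
      by (intro detour[OF fp pa' first_completes_before_last[OF fp a pa']]) auto
    then show ?thesis
      using detour_split[OF _ w_ge[OF \<open>\<not> same m p q\<close>[unfolded 2(1)]]] cost(1)
      unfolding walk_cost_rev 2(1) by (meson order_trans)
  next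
    case (3 j)
    then show ?thesis using \<open>pos p < pos q\<close> by simp
  qed
qed

text \<open>The first half of a sibling to be completed in the parent cluster is the one completed
  by \<open>e\<close>, so a cheap crossing must use an edge at \<open>e\<close>. It puts the agent
  at \<open>e\<close>, still a \<open>detour\<close> away from \<open>v\<close>.\<close>

lemma cost_return:
  assumes walk: "xs \<noteq> []" "hd xs = a" "last xs = v" "\<forall>u\<in>set (butlast xs). pos u < pos v"
    and a: "\<not> same (Suc j) a v"
    and e: "first_completes pos j (Suc j) e" "same (Suc j) e v"
    and before: "\<And>z. same (Suc (Suc j)) z e \<Longrightarrow> \<not> same (Suc j) z e \<Longrightarrow> pos e < pos z"
  shows "\<alpha> * 2 ^ Suc (Suc j) \<le> walk_cost w xs"
  using walk a
proof (cases rule: enter_crossing)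
  case (2 ys p q zs)
  have cost: "walk_cost w (q # zs) + w {p, q} \<le> walk_cost w xs" "0 \<le> walk_cost w (q # zs)"
    using 2(6) cost_nonneg by simp_all
  have qe: "same (Suc j) q e"
    using 2(4) e(2) same_sym same_trans by blast
  have qe': "same (Suc (Suc j)) q e"
    using same_mono[OF qe] by simp
  have pe: "same (Suc (Suc j)) p e" "\<not> same (Suc j) p e"
    using same_trans[OF 2(2) qe'] same_trans[OF _ same_sym[OF qe], of p] 2(3) by blast+
  have "pos e < pos p" by (rule before[OF pe])
  have c: "completes pos j e" "same (Suc (Suc j)) e p" "same (Suc (Suc j)) e q"
    using e(1) same_sym[OF pe(1)] same_sym[OF qe'] by (simp_all add: first_completes_def)
  from 2(2,3) show ?thesis
  proof (cases rule: w_siblings)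
    case 1
    then show ?thesis using cost by linarith
  next
    case (2 j')
    then have "pos p \<le> pos e"
      using c by (auto simp: first_completes_def)
    then show ?thesis using \<open>pos e < pos p\<close> by simp
  next
    case (3 j')
    then have "first_completes pos j (Suc j) q"
      using first_completes_shrink[of j "Suc (Suc j)" q "Suc j"] by simp
    then have "q = e"
      using first_completes_unique e(1) qe by blast
    then have "(\<alpha> - 1) * 2 ^ (j + 2) \<le> walk_cost w (q # zs)"
      using e \<open>pos e < pos p\<close> \<open>pos p < pos v\<close> walk(3) \<open>xs = ys @ p # q # zs\<close>
      by (intro detour[of j e v]) auto
    then show ?thesis
      using detour_split[OF _ w_ge[OF \<open>\<not> same (Suc j) p q\<close>]] cost(1) by (meson order_trans)
  qed
qed

text \<open>\<open>2 ^ merge_level v\<close> is the ultrametric distance from \<open>v\<close> to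
  the vertices visited before. It is unspecified for the first vertex, which the sums below leave
  out.\<close>

definition merge_level :: "nat \<Rightarrow> nat" where
  "merge_level v = (LEAST i. \<exists>z. same i z v \<and> pos z < pos v)"

lemma merge_level_le: "same i z v \<Longrightarrow> pos z < pos v \<Longrightarrow> merge_level v \<le> i"
  unfolding merge_level_def by (rule Least_le) blast

text \<open>The first vertex \<open>g\<close> of the half entered second has merge level
  \<open>Suc i\<close>; the remaining ones are counted inside their halves. The total is the weight
  of a minimum spanning tree for the lower bounds, whatever the order of visits.\<close>

lemma sum_merge_level:
  assumes "same i f x" "\<And>u. same i u x \<Longrightarrow> pos f \<le> pos u"
  shows "(\<Sum>u\<in>{u. same i u x} - {f}. (2::real) ^ merge_level u) = real i * 2 ^ i"
  using assms
proof (induction i arbitrary: x f)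
  case (0 x f)
  then have "{u. same 0 u x} - {f} = {}" by auto
  then show ?case by (simp only: sum.empty)
next
  case (Suc i x f)
  obtain y where y: "same (Suc i) y f" "\<not> same i y f"
    using sibling_exists by blast
  define S where "S = {u. same i u y}"
  have S: "finite S" "y \<in> S"
    by (simp_all add: S_def finite_cluster)
  then have "Min (pos ` S) \<in> pos ` S"
    by (intro Min_in) auto
  then obtain g where g: "g \<in> S" "pos g = Min (pos ` S)"
    by auto
  have gmin: "pos g \<le> pos u" if "same i u y" for u
    unfolding g(2) using S(1) that by (simp add: S_def)
  have gy: "same i g y" using g(1) by (simp add: S_def)
  have gf: "same (Suc i) g f"
    using same_trans[OF same_mono[OF gy] y(1)] by simp
  have sep: "\<not> (same i u f \<and> same i u y)" for u
    using y(2) same_trans[OF same_sym[of i u y]] by blast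
  have fmin: "pos f \<le> pos u" if "same (Suc i) u f" for u
    using Suc.prems(2)[OF same_trans[OF that Suc.prems(1)]] .
  have "g \<noteq> f" using gy y(2) same_sym by blast
  then have "pos f < pos g"
    using pos_less[OF fmin[OF gf]] by simp
  then have "merge_level g \<le> Suc i"
    using merge_level_le[OF same_sym[OF gf]] by simp
  moreover have "Suc i \<le> merge_level g"
  proof (rule ccontr)
    assume "\<not> Suc i \<le> merge_level g"
    have "\<exists>z. same (merge_level g) z g \<and> pos z < pos g"
      unfolding merge_level_def by (rule LeastI[of _ "Suc i"]) (use gf \<open>pos f < pos g\<close> same_sym in blast)
    then obtain z where "same i z g" "pos z < pos g"
      using \<open>\<not> Suc i \<le> merge_level g\<close> same_mono by (meson not_less_eq_eq)
    then show False
      using gmin[OF same_trans[OF _ gy]] by fastforce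
  qed
  ultimately have og: "merge_level g = Suc i" by simp
  have split: "same i u f \<or> same i u y" if "same (Suc i) u x" for u
    using same_two_children[of i u f y] same_two_children[of i u y f]
      same_trans[OF that same_sym[OF Suc.prems(1)]] y same_sym same_trans by blast
  have up: "same (Suc i) u x" if "same i u f \<or> same i u y" for u
    using that same_mono[of i u _ "Suc i"] same_trans[OF y(1) Suc.prems(1)] Suc.prems(1)
      same_trans by (meson le_SucI order_refl)
  have "{u. same (Suc i) u x} - {f} =
      insert g (({u. same i u f} - {f}) \<union> ({u. same i u y} - {g}))"
    using split up gy \<open>g \<noteq> f\<close> sep[of f] by auto
  also have "(\<Sum>u\<in>\<dots>. (2::real) ^ merge_level u) = 2 ^ merge_level g +
      (\<Sum>u\<in>({u. same i u f} - {f}) \<union> ({u. same i u y} - {g}). 2 ^ merge_level u)"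
    using finite_cluster sep[of g] gy by (intro sum.insert) auto
  also have "(\<Sum>u\<in>({u. same i u f} - {f}) \<union> ({u. same i u y} - {g}). (2::real) ^ merge_level u) =
      (\<Sum>u\<in>{u. same i u f} - {f}. 2 ^ merge_level u) + (\<Sum>u\<in>{u. same i u y} - {g}. 2 ^ merge_level u)"
    using finite_cluster sep by (intro sum.union_disjoint) auto
  also have "(\<Sum>u\<in>{u. same i u f} - {f}. (2::real) ^ merge_level u) = real i * 2 ^ i"
  proof (rule Suc.IH)
    show "pos f \<le> pos u" if "same i u f" for u
      using fmin same_mono[OF that] by simp
  qed simp
  also have "(\<Sum>u\<in>{u. same i u y} - {g}. (2::real) ^ merge_level u) = real i * 2 ^ i"
    using gy gmin by (rule Suc.IH)
  finally show ?case
    by (simp add: og algebra_simps)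
qed

text \<open>A pair \<^term>\<open>(j, e)\<close> is a debt at \<^term>\<open>a\<close> if the agent may have left the unfinished
  cluster of \<^term>\<open>e\<close> at level \<^term>\<open>Suc j\<close> through a cheap edge at \<^term>\<open>e\<close>. The debt is
  repaid when the agent comes back to that cluster.\<close>

definition debts :: "nat \<Rightarrow> nat \<Rightarrow> (nat \<times> nat) set" where
  "debts k a = {(j, e). Suc j < k \<and> e < 2 ^ k \<and> first_completes pos j (Suc j) e \<and>
     \<not> same (Suc j) a e \<and> (\<exists>z. same (Suc j) z e \<and> pos a < pos z) \<and>
     (\<forall>z. same (Suc (Suc j)) z e \<and> \<not> same (Suc j) z e \<longrightarrow> pos e < pos z) \<and>
     (\<exists>z. same (Suc (Suc j)) z e \<and> \<not> same (Suc j) z e \<and> pos z \<le> pos a)}"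

text \<open>The amount saved by a cheap edge from a cluster of level \<open>Suc j\<close> to its
  sibling: such an edge has level \<open>j + 2\<close>.\<close>

definition debt :: "nat \<times> nat \<Rightarrow> real" where
  "debt d = (\<alpha> - 1) * 2 ^ (fst d + 2)"

text \<open>A lower bound for the cost paid so far: \<open>\<alpha>\<close> times the spanning tree
  weight collected by first visits, less the savings not yet repaid.\<close>

definition potential :: "nat \<Rightarrow> nat \<Rightarrow> real" where
  "potential k a = \<alpha> * (\<Sum>u | u < 2 ^ k \<and> 0 < pos u \<and> pos u \<le> pos a. 2 ^ merge_level u) -
     sum debt (debts k a)"

lemma debt_nonneg: "0 \<le> debt d"
  using alpha by (simp add: debt_def)

lemma finite_debts: "finite (debts k a)"
  by (rule finite_subset[of _ "{..<k} \<times> {..<2 ^ k}"]) (auto simp: debts_def)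

lemma potential_start:
  assumes "pos s = 0"
  shows "potential k s \<le> 0"
proof -
  have none: "{u. u < 2 ^ k \<and> 0 < pos u \<and> pos u \<le> pos s} = {}"
    using assms by auto
  have "0 \<le> sum debt (debts k s)"
    using debt_nonneg by (rule sum_nonneg)
  then show ?thesis
    unfolding potential_def none by simp
qed

lemma potential_end:
  assumes s: "s < 2 ^ k" "pos s = 0" and a: "\<And>u. u < 2 ^ k \<Longrightarrow> pos u \<le> pos a"
  shows "potential k a = \<alpha> * (real k * 2 ^ k)"
proof -
  have "z < 2 ^ k" if "same (Suc j) z e" "Suc j < k" "e < 2 ^ k" for j z e
    using same_less[OF that(1) less_imp_le[OF that(2)] that(3)] .
  then have "\<not> pos a < pos z" if "same (Suc j) z e" "Suc j < k" "e < 2 ^ k" for j z e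
    using a that by (meson not_le)
  then have "debts k a = {}"
    unfolding debts_def by blast
  moreover have cl: "same k u s \<longleftrightarrow> u < 2 ^ k" for u
    using s(1) by (simp add: same_def div_eq_0_iff)
  have "{u. u < 2 ^ k \<and> 0 < pos u \<and> pos u \<le> pos a} = {u. same k u s} - {s}"
  proof -
    have "0 < pos u \<longleftrightarrow> u \<noteq> s" for u
      using pos_eq_iff[of u s] s(2) by auto
    then show ?thesis using a cl by auto
  qed
  moreover have "(\<Sum>u\<in>{u. same k u s} - {s}. (2::real) ^ merge_level u) = real k * 2 ^ k"
    by (rule sum_merge_level) (simp_all add: s(2))
  ultimately show ?thesis
    by (simp add: potential_def)
qed

lemma sum_powers: "n \<le> m \<Longrightarrow> (\<Sum>j = n..<m. (2::real) ^ (j + 2)) = 2 ^ (m + 2) - 2 ^ (n + 2)"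
  by (induction m rule: dec_induct) auto

text \<open>If \<open>v\<close> opens the sibling of a cluster containing \<open>a\<close>, the
  agent pays the full price or incurs a debt for the difference. Otherwise
  \<open>merge_level v\<close> is below the level crossed, and the crossing also covers the repaid
  debts, which are bounded by a geometric sum.\<close>

lemma potential_step:
  assumes walk: "xs \<noteq> []" "hd xs = a" "last xs = v" "\<forall>u\<in>set (butlast xs). pos u < pos v"
    and av: "a < 2 ^ k" "v < 2 ^ k" "pos a < pos v"
    and latest: "\<forall>u. pos u < pos v \<longrightarrow> pos u \<le> pos a"
  shows "potential k v \<le> potential k a + walk_cost w xs"
proof -
  have "a \<noteq> v" using av(3) by auto
  then have "0 < lev a v"
    using less_lev[of 0 a v] by simp
  then obtain m where m: "lev a v = Suc m"
    using gr0_implies_Suc by blast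
  have sib: "same (Suc m) a v" "\<not> same m a v"
    using same_lev[of a v] lev_le[of m a v] m by auto
  have "same k a v"
    using av(1,2) by (simp add: same_def)
  then have "Suc m \<le> k"
    using lev_le m by metis
  have cost: "2 ^ Suc m \<le> walk_cost w xs"
    by (rule cost_ge[OF walk(1-3) sib(2)])
  have "{u. u < 2 ^ k \<and> 0 < pos u \<and> pos u \<le> pos v} =
      insert v {u. u < 2 ^ k \<and> 0 < pos u \<and> pos u \<le> pos a}"
  proof -
    have "pos u \<le> pos v \<longleftrightarrow> u = v \<or> pos u \<le> pos a" for u
      using latest pos_less[of u v] av(3) by (metis less_imp_le order_refl order_trans)
    then show ?thesis using av by auto
  qed
  then have opened: "(\<Sum>u | u < 2 ^ k \<and> 0 < pos u \<and> pos u \<le> pos v. (2::real) ^ merge_level u) =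
      2 ^ merge_level v + (\<Sum>u | u < 2 ^ k \<and> 0 < pos u \<and> pos u \<le> pos a. 2 ^ merge_level u)"
    using av(3) by simp
  \<comment> \<open>\<open>R\<close> collects the debts repaid by reaching \<open>v\<close>; their
    clusters contain \<open>v\<close> but not \<open>a\<close>.\<close>
  define R where "R = debts k a - debts k v"
  have R: "same (Suc j) e v \<and> merge_level v \<le> Suc j \<and> Suc j \<le> m \<and>
      first_completes pos j (Suc j) e \<and>
      (\<forall>z. same (Suc (Suc j)) z e \<and> \<not> same (Suc j) z e \<longrightarrow> pos e < pos z)"
    if "(j, e) \<in> R" for j e
  proof -
    have d: "Suc j < k" "e < 2 ^ k" "first_completes pos j (Suc j) e" "\<not> same (Suc j) a e"
      "\<exists>z. same (Suc j) z e \<and> pos a < pos z"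
      "\<forall>z. same (Suc (Suc j)) z e \<and> \<not> same (Suc j) z e \<longrightarrow> pos e < pos z"
      "\<exists>z. same (Suc (Suc j)) z e \<and> \<not> same (Suc j) z e \<and> pos z \<le> pos a"
      using that by (auto simp: R_def debts_def)
    have ev: "same (Suc j) e v"
    proof (rule ccontr)
      assume no: "\<not> same (Suc j) e v"
      obtain z where z: "same (Suc j) z e" "pos a < pos z"
        using d(5) by blast
      have "z \<noteq> v" using z(1) no same_sym by blast
      moreover have "pos v \<le> pos z"
        using latest z(2) by (meson not_le)
      ultimately have "pos v < pos z"
        using pos_less[of v z] by simp
      moreover obtain y where "same (Suc (Suc j)) y e" "\<not> same (Suc j) y e" "pos y \<le> pos v"
        using d(7) av(3) by (meson less_imp_le order_trans)
      ultimately have "(j, e) \<in> debts k v"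
        using d(1,2,3,6) z(1) no same_sym unfolding debts_def by blast
      then show False using that by (simp add: R_def)
    qed
    have "pos e < pos v"
      using d(6,7) av(3) by (meson less_le_trans less_trans)
    then have "merge_level v \<le> Suc j"
      by (rule merge_level_le[OF ev])
    moreover have "Suc j \<le> m"
    proof (rule ccontr)
      assume "\<not> Suc j \<le> m"
      then have "same (Suc j) a v"
        using same_mono[OF sib(1)] by simp
      then show False
        using d(4) same_trans[OF _ same_sym[OF ev]] by blast
    qed
    ultimately show ?thesis using d ev by blast
  qed
  have debts_le: "sum debt (debts k a) \<le> sum debt (debts k v) + sum debt R"
  proof -
    have "sum debt (debts k a) \<le> sum debt (debts k v \<union> R)"
      by (rule sum_mono2) (auto simp: R_def finite_debts debt_nonneg)
    also have "\<dots> = sum debt (debts k v) + sum debt R"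
      by (rule sum.union_disjoint) (auto simp: R_def finite_debts)
    finally show ?thesis .
  qed
  have goal: ?thesis
    if "\<alpha> * 2 ^ merge_level v + sum debt (debts k a) \<le> sum debt (debts k v) + walk_cost w xs"
    using that unfolding potential_def opened by (simp add: algebra_simps)
  have open_le: "merge_level v \<le> Suc m"
    by (rule merge_level_le[OF sib(1) av(3)])
  show ?thesis
  proof (cases "merge_level v = Suc m")
    case True
    then have "R = {}" using R by fastforce
    then have sub: "debts k a \<subseteq> debts k v" by (simp add: R_def)
    have new: "\<forall>z. same m z v \<longrightarrow> pos v \<le> pos z"
      using merge_level_le[of m _ v] True by (metis Suc_n_not_le_n not_le)
    \<comment> \<open>The question is whether the cluster left behind is unfinished although one of
      its halves is complete, so that its cheap exit may be in use.\<close>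
    show ?thesis
    proof (cases "\<exists>j e z. m = Suc j \<and> first_completes pos j m e \<and> same m e a \<and> pos e < pos v \<and>
        same m z a \<and> \<not> pos z < pos v")
      case False
      then have "\<alpha> * 2 ^ Suc m \<le> walk_cost w xs"
        by (intro cost_enter_new[OF walk latest sib new]) blast
      then show ?thesis
        using goal debts_le \<open>R = {}\<close> True by simp
    next
      case True
      then obtain j e z where je: "m = Suc j" "first_completes pos j m e" "same m e a"
        "pos e < pos v" and z: "same m z a" "\<not> pos z < pos v"
        by blast
      have "z \<noteq> v" using z(1) sib(2) same_sym by blast
      then have zv: "pos v < pos z" using z(2) pos_less[of v z] by simp
      have nve: "\<not> same m v e"
        using sib(2) je(3) same_sym same_trans by blast
      have "same (Suc m) v e"
        using same_trans[OF same_sym[OF sib(1)] same_mono[OF same_sym[OF je(3)]]] by simp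
      moreover have "pos e < pos y" if "same (Suc m) y e" "\<not> same m y e" for y
        using new same_two_children[OF that(1) \<open>same (Suc m) v e\<close> that(2) nve] je(4)
        by (meson less_le_trans)
      moreover have "e < 2 ^ k"
        using same_less[OF je(3) _ av(1)] \<open>Suc m \<le> k\<close> by simp
      moreover have "same m z e"
        using z(1) je(3) same_sym same_trans by blast
      ultimately have "(j, e) \<in> debts k v"
        using je(1,2) nve zv \<open>Suc m \<le> k\<close> unfolding debts_def by auto
      moreover have "(j, e) \<notin> debts k a"
        using je(1,3) same_sym by (auto simp: debts_def)
      ultimately have "sum debt (insert (j, e) (debts k a)) \<le> sum debt (debts k v)"
        using sub by (intro sum_mono2) (auto simp: finite_debts debt_nonneg)
      then have "debt (j, e) + sum debt (debts k a) \<le> sum debt (debts k v)"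
        using \<open>(j, e) \<notin> debts k a\<close> by (simp add: finite_debts)
      \<comment> \<open>The new debt tops up the price of a cheap edge to the full price.\<close>
      moreover have "debt (j, e) + 2 ^ Suc m = \<alpha> * 2 ^ Suc m"
        by (simp add: debt_def je(1) algebra_simps)
      ultimately show ?thesis
        using goal cost \<open>merge_level v = Suc m\<close> by simp
    qed
  next
    case False
    then have om: "merge_level v \<le> m" using open_le by simp
    have "merge_level v \<noteq> 0"
    proof
      assume "merge_level v = 0"
      have "\<exists>z. same (merge_level v) z v \<and> pos z < pos v"
        unfolding merge_level_def by (rule LeastI[of _ "Suc m"]) (use sib(1) av(3) in blast)
      then show False using \<open>merge_level v = 0\<close> by auto
    qed
    then obtain n where n: "merge_level v = Suc n" using not0_implies_Suc by blast
    obtain j where j: "m = Suc j" using om n by (cases m) auto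
    \<comment> \<open>All repaid clusters contain \<open>v\<close>, so the level determines the
      cluster and thereby \<open>e\<close>: at most one debt per level.\<close>
    have "inj_on fst R"
    proof (rule inj_onI, clarify)
      fix i e i' e' assume "(i, e) \<in> R" "(i', e') \<in> R" "fst (i, e) = fst (i', e')"
      then show "i = i' \<and> e = e'"
        using R[of i e] R[of i' e'] first_completes_unique same_sym same_trans
        by (metis fst_conv)
    qed
    then have sumR: "sum debt R = (\<Sum>i\<in>fst ` R. (\<alpha> - 1) * 2 ^ (i + 2))"
      by (simp add: sum.reindex debt_def)
    have sub: "fst ` R \<subseteq> {n..<m}"
      using R n by force
    have bound: "sum debt R \<le> (\<alpha> - 1) * (2 ^ (l + 2) - 2 ^ (n + 2))"
      if "fst ` R \<subseteq> {n..<l}" "n \<le> l" for l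
    proof -
      have "sum debt R \<le> (\<Sum>i = n..<l. (\<alpha> - 1) * 2 ^ (i + 2))"
        unfolding sumR using that(1) alpha by (intro sum_mono2) auto
      also have "\<dots> = (\<alpha> - 1) * (2 ^ (l + 2) - 2 ^ (n + 2))"
        using sum_powers[OF that(2)] by (simp add: sum_distrib_left[symmetric])
      finally show ?thesis .
    qed
    \<comment> \<open>With \<open>X = 2 ^ Suc j\<close> and \<open>N = 2 ^ Suc n\<close>, both cases
      below reduce to \<open>(2 - \<alpha>) * (2 * X - N) \<ge> 0\<close>, which follows from
      \<open>slack\<close> and \<open>slack0\<close>.\<close>
    have "(2 - \<alpha>) * 2 ^ Suc n \<le> (2 - \<alpha>) * 2 ^ Suc j"
      using alpha om n j by (intro mult_left_mono power_increasing) auto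
    then have slack: "2 * 2 ^ Suc n - \<alpha> * 2 ^ Suc n \<le> 2 * 2 ^ Suc j - \<alpha> * 2 ^ Suc j"
      by (simp add: algebra_simps)
    have slack0: "\<alpha> * 2 ^ Suc j \<le> 2 * 2 ^ Suc j"
      using alpha by simp
    \<comment> \<open>A debt at the top level \<open>j\<close> makes \<open>cost_return\<close>
      applicable. Without it the crossing is only known to cost \<open>2 ^ Suc m\<close>, but the
      geometric sum stops one level earlier.\<close>
    have "\<alpha> * 2 ^ merge_level v + sum debt R \<le> walk_cost w xs"
    proof (cases "j \<in> fst ` R")
      case True
      then obtain e where "(j, e) \<in> R" by auto
      from R[OF this] have "\<alpha> * 2 ^ Suc (Suc j) \<le> walk_cost w xs"
        using sib(2) unfolding j by (intro cost_return[OF walk]) auto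
      moreover have "(\<alpha> - 1) * (2 ^ (Suc j + 2) - 2 ^ (n + 2)) =
          4 * (\<alpha> * 2 ^ Suc j) - 2 * (\<alpha> * 2 ^ Suc n) - 4 * 2 ^ Suc j + 2 * 2 ^ Suc n"
        by (simp add: algebra_simps)
      moreover have "\<alpha> * 2 ^ Suc (Suc j) = 2 * (\<alpha> * 2 ^ Suc j)"
        by simp
      ultimately show ?thesis
        using bound[OF sub] om slack slack0 unfolding n j by linarith
    next
      case False
      moreover have "{n..<Suc j} \<subseteq> insert j {n..<j}"
        by auto
      ultimately have "fst ` R \<subseteq> {n..<j}"
        using sub unfolding j by blast
      moreover have "(\<alpha> - 1) * (2 ^ (j + 2) - 2 ^ (n + 2)) =
          2 * (\<alpha> * 2 ^ Suc j) - 2 * (\<alpha> * 2 ^ Suc n) - 2 * 2 ^ Suc j + 2 * 2 ^ Suc n"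
        by (simp add: algebra_simps)
      moreover have "(2::real) ^ Suc (Suc j) = 2 * 2 ^ Suc j"
        by simp
      ultimately show ?thesis
        using bound[of j] cost om slack slack0 unfolding n j by linarith
    qed
    then show ?thesis
      using goal debts_le by simp
  qed
qed

end

section \<open>The instance and the run against the adversary\<close>

definition cluster_instance :: "real \<Rightarrow> nat \<Rightarrow> nat announced" where
  "cluster_instance \<alpha> k =
     \<lparr>verts = {..<2 ^ k}, edges = {e. e \<subseteq> {..<2 ^ k} \<and> card e = 2}, source = 0, target = 1,
      lower = (\<lambda>e. 2 ^ lev (Min e) (Max e)), upper = (\<lambda>e. \<alpha> * 2 ^ lev (Min e) (Max e))\<rparr>"

lemma cluster_instance_simps [simp]:
  "verts (cluster_instance \<alpha> k) = {..<2 ^ k}"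
  "source (cluster_instance \<alpha> k) = 0" "target (cluster_instance \<alpha> k) = 1"
  "lower (cluster_instance \<alpha> k) e = 2 ^ lev (Min e) (Max e)"
  "upper (cluster_instance \<alpha> k) e = \<alpha> * 2 ^ lev (Min e) (Max e)"
  by (simp_all add: cluster_instance_def)

lemma edge_iff:
  "{x, y} \<in> edges (cluster_instance \<alpha> k) \<longleftrightarrow> x < 2 ^ k \<and> y < 2 ^ k \<and> x \<noteq> y"
  by (auto simp: cluster_instance_def card_insert_if)

lemma edgeE:
  assumes "e \<in> edges (cluster_instance \<alpha> k)" "x \<in> e"
  obtains y where "e = {x, y}" "x < 2 ^ k"
proof -
  have "card e = 2" "e \<subseteq> {..<2 ^ k}"
    using assms(1) by (simp_all add: cluster_instance_def)
  then obtain a b where "e = {a, b}"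
    by (auto simp: card_2_iff)
  then show thesis
    using that[of a] that[of b] assms(2) \<open>e \<subseteq> {..<2 ^ k}\<close> by (auto simp: insert_commute)
qed

context adversary
begin

lemma instance_valid:
  assumes "1 \<le> k"
  shows "geewe_instance (cluster_instance \<alpha> k) w"
proof -
  let ?P = "cluster_instance \<alpha> k"
  have "(x, y) \<in> {(a, b). {a, b} \<in> edges ?P}\<^sup>*" if "x < 2 ^ k" "y < 2 ^ k" for x y
    using that by (cases "x = y") (auto simp: edge_iff)
  then have "connected_graph (verts ?P) (edges ?P)"
    by (auto simp: connected_graph_def cluster_instance_def)
  moreover have "(1::nat) < 2 ^ k"
    using assms by (intro one_less_power) auto
  moreover have "lower ?P e \<le> w e \<and> w e \<le> upper ?P e" for e
    using alpha by (simp add: weight_def pair_weight_def)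
  moreover have "0 < lower ?P e \<and> lower ?P e \<le> upper ?P e" for e
    using alpha by simp
  ultimately show ?thesis
    by (simp add: geewe_instance_def)
qed

text \<open>The tour from \<open>cheap_tour\<close> has uncontrolled ends; linking them to 0 and 1
  costs at most \<open>2 * 2 ^ k\<close> each. With \<open>k = Suc i\<close> and
  \<open>\<alpha> \<le> 2\<close>, the factor \<open>i + \<alpha> + 4\<close> is at most
  \<open>k + 5\<close>.\<close>

lemma cheap_exploration:
  assumes "1 \<le> k"
  shows "\<exists>xs. exploration_walk (cluster_instance \<alpha> k) xs \<and> walk_cost w xs \<le> (real k + 5) * 2 ^ k"
proof -
  obtain i where k: "k = Suc i" using assms by (cases k) auto
  obtain ps where ps: "ps \<noteq> []" "set ps = {u. same k u 0}" "successively (\<noteq>) ps"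
    "walk_cost w ps \<le> (real i + \<alpha>) * 2 ^ k"
    using cheap_tour[of i 0] unfolding k by blast
  have V: "set ps = {..<2 ^ k}"
    unfolding ps(2) by (auto simp: same_zero_iff)
  have w_le: "w {x, y} \<le> 2 * 2 ^ k" if "x < 2 ^ k" "y < 2 ^ k" for x y
  proof -
    have "same k x y" using that by (simp add: same_def)
    then have "(2::real) ^ lev x y \<le> 2 ^ k"
      using lev_le by (intro power_increasing) auto
    then have "\<alpha> * 2 ^ lev x y \<le> 2 * 2 ^ k"
      using alpha by (intro mult_mono) auto
    then show ?thesis using w_bounds(2)[of x y] by linarith
  qed
  define qs where "qs = (if hd ps = 0 then ps else 0 # ps)"
  have V': "(0::nat) < 2 ^ k" "(1::nat) < 2 ^ k" "hd ps < 2 ^ k"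
  proof -
    show "(1::nat) < 2 ^ k" using assms by (intro one_less_power) auto
    show "hd ps < 2 ^ k" using hd_in_set[OF ps(1)] V by blast
  qed simp
  have edges: "successively (\<lambda>x y. {x, y} \<in> edges (cluster_instance \<alpha> k)) xs"
    if "successively (\<noteq>) xs" "set xs \<subseteq> {..<2 ^ k}" for xs
    using that by (induction xs rule: induct_list012) (auto simp: edge_iff)
  have qs: "qs \<noteq> []" "hd qs = 0" "successively (\<noteq>) qs"
    using ps(1,3) by (auto simp: qs_def successively_Cons)
  have set_qs: "set qs = {..<2 ^ k}"
    using V V'(1) by (simp add: qs_def insert_absorb)
  have cost_qs: "walk_cost w qs \<le> walk_cost w ps + 2 * 2 ^ k"
    using w_le[OF V'(1,3)] walk_cost_join[where ps = "[0]" and qs = ps and w = w] ps(1) by (simp add: qs_def)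
  define xs where "xs = (if last qs = 1 then qs else qs @ [1])"
  have "last qs < 2 ^ k"
    using last_in_set[OF qs(1)] set_qs by blast
  then have cost_xs: "walk_cost w xs \<le> walk_cost w qs + 2 * 2 ^ k"
    using w_le[OF _ V'(2)] walk_cost_join[OF qs(1), where qs = "[1]" and w = w] by (simp add: xs_def)
  have xs: "xs \<noteq> []" "hd xs = 0" "last xs = 1" "successively (\<noteq>) xs"
    using qs by (simp_all add: xs_def successively_append_iff)
  have set_xs: "set xs = {..<2 ^ k}"
    using set_qs V'(2) by (simp add: xs_def insert_absorb)
  have "exploration_walk (cluster_instance \<alpha> k) xs"
    using xs set_xs edges[of xs] by (simp add: exploration_walk_def)
  moreover have "walk_cost w xs \<le> (real i + \<alpha> + 4) * 2 ^ k"
    using cost_xs cost_qs ps(4) by (simp add: algebra_simps)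
  moreover have "(real i + \<alpha> + 4) * 2 ^ k \<le> (real k + 5) * 2 ^ k"
    using alpha k by (intro mult_right_mono) auto
  ultimately show ?thesis by (meson order_trans)
qed

end

text \<open>Unvisited vertices get distinct times after all visited ones, so that every list, also
  an incomplete run, yields an injective order as \<open>adversary\<close> demands.\<close>

definition first_index :: "nat list \<Rightarrow> nat \<Rightarrow> nat" where
  "first_index xs v =
     (if v \<in> set xs then LEAST i. i < length xs \<and> xs ! i = v else length xs + v)"

lemma first_index_nth:
  assumes "v \<in> set xs"
  shows "first_index xs v < length xs" "xs ! first_index xs v = v"
proof -
  have "\<exists>i. i < length xs \<and> xs ! i = v"
    using assms by (simp add: in_set_conv_nth)
  from LeastI_ex[OF this] show "first_index xs v < length xs" "xs ! first_index xs v = v"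
    using assms by (simp_all add: first_index_def)
qed

lemma first_index_le: "i < length xs \<Longrightarrow> first_index xs (xs ! i) \<le> i"
  by (simp add: first_index_def Least_le)

lemma first_index_notin: "v \<notin> set xs \<Longrightarrow> first_index xs v = length xs + v"
  by (simp add: first_index_def)

lemma inj_first_index: "inj (first_index xs)"
proof (rule injI)
  fix u v assume eq: "first_index xs u = first_index xs v"
  then have iff: "u \<in> set xs \<longleftrightarrow> v \<in> set xs"
    using first_index_nth(1)[of u xs] first_index_nth(1)[of v xs]
      first_index_notin[of u xs] first_index_notin[of v xs] by linarith
  show "u = v"
  proof (cases "u \<in> set xs")
    case True
    with iff eq show ?thesis
      using first_index_nth(2)[of u xs] first_index_nth(2)[of v xs] by metis
  next
    case False
    with iff eq show ?thesis by (simp add: first_index_notin)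
  qed
qed

lemma adversary_first_index: "1 \<le> \<alpha> \<Longrightarrow> \<alpha> \<le> 2 \<Longrightarrow> adversary \<alpha> (first_index xs)"
  by (simp add: adversary_def inj_first_index)

lemma first_index_append:
  assumes "v \<in> set xs"
  shows "first_index (xs @ ys) v = first_index xs v"
proof (rule antisym)
  have i: "first_index xs v < length xs" "xs ! first_index xs v = v"
    using first_index_nth[OF assms] .
  show le: "first_index (xs @ ys) v \<le> first_index xs v"
    using first_index_le[of "first_index xs v" "xs @ ys"] i by (simp add: nth_append)
  have "(xs @ ys) ! first_index (xs @ ys) v = v"
    using first_index_nth(2)[of v "xs @ ys"] assms by simp
  then show "first_index xs v \<le> first_index (xs @ ys) v"
    using first_index_le[of "first_index (xs @ ys) v" xs] le i by (simp add: nth_append)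
qed

lemma first_index_append_notin:
  assumes "v \<notin> set xs"
  shows "length xs \<le> first_index (xs @ ys) v"
proof (rule ccontr)
  assume "\<not> length xs \<le> first_index (xs @ ys) v"
  moreover from this have "v \<in> set (xs @ ys)"
    using first_index_notin[of v "xs @ ys"] by auto
  ultimately have "v \<in> set xs"
    using first_index_nth[of v "xs @ ys"] by (metis not_le nth_append nth_mem)
  then show False using assms by simp
qed

text \<open>Continuing the run rearranges only vertices off \<open>xs\<close>, which no weight at a
  visited vertex can see.\<close>

lemma weight_append:
  assumes "e \<in> edges (cluster_instance \<alpha> k)" "e \<inter> set xs \<noteq> {}"
  shows "weight \<alpha> (first_index (xs @ ys)) e = weight \<alpha> (first_index xs) e"
proof -
  obtain x where x: "x \<in> e" "x \<in> set xs" using assms(2) by blast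
  obtain y where e: "e = {x, y}" using edgeE[OF assms(1) x(1)] by blast
  have "first_index xs u < first_index (xs @ ys) z" "first_index xs u < first_index xs z"
    if "u \<in> set xs" "z \<notin> set xs" for u z
    using first_index_nth(1)[OF that(1)] first_index_append_notin[OF that(2), of ys]
      first_index_notin[OF that(2)] by simp_all
  then show ?thesis
    unfolding e
    by (intro weight_online[of x "set xs"]) (simp_all add: x(2) first_index_append)
qed

text \<open>The move to the last vertex is chosen before that vertex is reached, hence
  \<open>butlast\<close>: edges revealed only there may differ.\<close>

lemma partial_run_cong:
  assumes "partial_run A P w xs"
    and "\<And>e. e \<in> edges P \<Longrightarrow> e \<inter> set (butlast xs) \<noteq> {} \<Longrightarrow> w' e = w e"
  shows "partial_run A P w' xs"
  using assms
proof (induction rule: partial_run.induct)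
  case start
  show ?case by (rule partial_run.start)
next
  case (move xs v)
  have "partial_run A P w' xs"
    using move.prems in_set_butlastD by (intro move.IH) fastforce
  moreover have "revealed P w' xs = revealed P w xs"
    using move.prems by (auto simp: revealed_def fun_eq_iff)
  ultimately show ?case
    using move.hyps(2) by (intro partial_run.move) simp_all
qed

lemma partial_run_appendD:
  "partial_run A P w (xs @ ys) \<Longrightarrow> xs \<noteq> [] \<Longrightarrow> partial_run A P w xs"
proof (induction ys rule: rev_induct)
  case (snoc y ys)
  from snoc.prems(1) have "partial_run A P w (xs @ ys)"
    by (cases rule: partial_run.cases) (use snoc.prems(2) in auto)
  then show ?case using snoc by simp
qed simp

lemma partial_run_prefix_of_produces:
  assumes ys: "partial_run A P w ys" and zs: "produces A P w zs"
  obtains us where "zs = ys @ us"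
proof -
  have rz: "partial_run A P w zs" and stop: "A P zs (revealed P w zs) = None"
    using zs by (simp_all add: produces_def)
  have "length ys \<le> length zs"
  proof (rule ccontr)
    assume "\<not> length ys \<le> length zs"
    then have "take (length zs) ys = zs" "length zs < length ys"
      using partial_run_prefix_eq[OF rz ys] by simp_all
    then show False
      using partial_run_take_step[OF ys, of "length zs"] partial_run_nonempty[OF rz] stop by simp
  qed
  then have "take (length ys) zs = ys"
    by (rule partial_run_prefix_eq[OF ys rz])
  then show thesis
    using that[of "drop (length ys) zs"] by (metis append_take_drop_id)
qed

text \<open>The weights seen along a run depend only on the run so far. A run consistent with its own
  order of first visits that reaches as many vertices as possible reaches all of them.\<close>

lemma adversarial_run:
  assumes alg: "geewe_algorithm A" and \<alpha>: "1 \<le> \<alpha>" "\<alpha> \<le> 2" and k: "1 \<le> k"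
  shows "\<exists>zs. produces A (cluster_instance \<alpha> k) (weight \<alpha> (first_index zs)) zs \<and>
    exploration_walk (cluster_instance \<alpha> k) zs"
proof -
  let ?P = "cluster_instance \<alpha> k"
  let ?w = "\<lambda>ys. weight \<alpha> (first_index ys)"
  \<comment> \<open>With the weights frozen at those induced by \<open>ys\<close> the instance is
    valid, so the algorithm must extend \<open>ys\<close> to an exploration.\<close>
  have final: "\<exists>us. produces A ?P (?w ys) (ys @ us) \<and> exploration_walk ?P (ys @ us)"
    if "partial_run A ?P (?w ys) ys" for ys
  proof -
    interpret adversary \<alpha> "first_index ys"
      using \<alpha> by (rule adversary_first_index)
    obtain zs where "produces A ?P (?w ys) zs" "exploration_walk ?P zs"
      using alg instance_valid[OF k] unfolding geewe_algorithm_def by blast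
    then show ?thesis
      using partial_run_prefix_of_produces[OF that] by blast
  qed
  have "card (set ys) < Suc (2 ^ k)" if "partial_run A ?P (?w ys) ys" for ys
  proof -
    from final[OF that] obtain us where "exploration_walk ?P (ys @ us)" by blast
    then have "set ys \<subseteq> {..<2 ^ k}" by (auto simp: exploration_walk_def)
    from card_mono[OF _ this] show ?thesis by simp
  qed
  moreover have "partial_run A ?P (?w [0]) [0]"
    using partial_run.start[of A ?P "?w [0]"] by simp
  ultimately obtain ys where ys: "partial_run A ?P (?w ys) ys"
    and greatest: "\<And>zs. partial_run A ?P (?w zs) zs \<Longrightarrow> card (set zs) \<le> card (set ys)"
    using ex_has_greatest_nat[of "\<lambda>ys. partial_run A ?P (?w ys) ys" "[0]" "\<lambda>ys. card (set ys)"]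
    by metis
  from final[OF ys] obtain us where us: "produces A ?P (?w ys) (ys @ us)"
    "exploration_walk ?P (ys @ us)" by blast
  have all: "set us \<subseteq> set ys"
  proof (rule ccontr)
    assume "\<not> set us \<subseteq> set ys"
    then have "\<exists>v\<in>set us. v \<notin> set ys" by blast
    then obtain bs v cs where split: "us = bs @ v # cs" "v \<notin> set ys" "\<forall>u\<in>set bs. \<not> u \<notin> set ys"
      by (rule split_list_first_propE)
    \<comment> \<open>The run is cut right after its first new vertex \<open>v\<close>. All
      decisions up to there saw only edges at \<open>ys\<close>, so it is also a run against its own
      weights, and it has more vertices.\<close>
    let ?zs = "ys @ bs @ [v]"
    have "partial_run A ?P (?w ys) (?zs @ cs)"
      using us(1) split(1) by (simp add: produces_def)
    then have "partial_run A ?P (?w ys) ?zs"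
      by (rule partial_run_appendD) simp
    then have "partial_run A ?P (?w ?zs) ?zs"
    proof (rule partial_run_cong)
      fix e assume e: "e \<in> edges ?P" "e \<inter> set (butlast ?zs) \<noteq> {}"
      have "set (butlast ?zs) \<subseteq> set ys"
        using split(3) by (auto simp: butlast_append)
      then show "?w ?zs e = ?w ys e"
        using e by (intro weight_append[of e \<alpha> k]) auto
    qed
    then have "card (set ?zs) \<le> card (set ys)" by (rule greatest)
    moreover have "card (insert v (set ys)) \<le> card (set ?zs)"
      by (rule card_mono) auto
    ultimately show False using split(2) by simp
  qed
  have "set ys = {..<2 ^ k}"
    using us(2) all by (auto simp: exploration_walk_def)
  \<comment> \<open>Every edge has an end in \<open>ys\<close>, so the rest of the walk changes no
    weight.\<close>
  then have "e \<inter> set ys \<noteq> {}" if "e \<in> edges ?P" for e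
    using that by (fastforce simp: cluster_instance_def card_2_iff)
  then have eq: "?w (ys @ us) e = ?w ys e" if "e \<in> edges ?P" for e
    using that weight_append by blast
  then have "revealed ?P (?w (ys @ us)) (ys @ us) = revealed ?P (?w ys) (ys @ us)"
    by (auto simp: revealed_def fun_eq_iff)
  then have "produces A ?P (?w (ys @ us)) (ys @ us)"
    using us(1) partial_run_cong[of A ?P "?w ys" "ys @ us" "?w (ys @ us)"] eq
    by (simp add: produces_def)
  then show ?thesis using us(2) by blast
qed

text \<open>\<open>potential_step\<close> is summed over consecutive first visits, from potential at
  most 0 up to the value in \<open>potential_end\<close>.\<close>

lemma adversarial_cost:
  assumes \<alpha>: "1 \<le> \<alpha>" "\<alpha> \<le> 2" and zs: "set zs = {..<2 ^ k}"
  shows "\<alpha> * (real k * 2 ^ k) \<le> walk_cost (weight \<alpha> (first_index zs)) zs"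
proof -
  interpret adversary \<alpha> "first_index zs"
    using \<alpha> by (rule adversary_first_index)
  let ?pos = "first_index zs"
  have "0 \<in> set zs" using zs by simp
  then have ne: "zs \<noteq> []" by auto
  have nth: "?pos u < length zs" "zs ! ?pos u = u" if "u < 2 ^ k" for u
    using first_index_nth[of u zs] zs that by auto
  have V: "zs ! n < 2 ^ k" if "n < length zs" for n
    using nth_mem[OF that] zs by auto
  have late: "length zs \<le> ?pos u" if "\<not> u < 2 ^ k" for u
    using first_index_notin[of u zs] zs that by simp
  have prefix: "potential k (zs ! n) \<le> walk_cost w (take (Suc n) zs)"
    if "n < length zs" "?pos (zs ! n) = n" for n
    using that
  proof (induction n rule: less_induct)
    case (less n)
    show ?case
    proof (cases "n = 0")
      case True
      have "potential k (zs ! 0) \<le> 0"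
        using less.prems True by (intro potential_start) simp
      then show ?thesis
        using ne True by (cases zs) auto
    next
      case False
      \<comment> \<open>\<open>l\<close> is the time of the preceding first visit.\<close>
      define l where "l = Max {i. i < n \<and> ?pos (zs ! i) = i}"
      have "?pos (zs ! 0) = 0"
        using first_index_le[of 0 zs] ne by simp
      then have "l \<in> {i. i < n \<and> ?pos (zs ! i) = i}"
        unfolding l_def using False by (intro Max_in) auto
      then have l: "l < n" "?pos (zs ! l) = l" by auto
      have lmax: "i \<le> l" if "i < n" "?pos (zs ! i) = i" for i
        unfolding l_def using that by (intro Max_ge) auto
      define xs where "xs = take (Suc n - l) (drop l zs)"
      have len: "length xs = Suc n - l"
        using less.prems(1) l(1) by (simp add: xs_def)
      have xs_nth: "xs ! i = zs ! (l + i)" if "i < Suc n - l" for i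
        using that less.prems(1) by (simp add: xs_def)
      have ne_xs: "xs \<noteq> []"
        using len l(1) by auto
      have xs: "hd xs = zs ! l" "last xs = zs ! n"
        using len l(1) xs_nth[of 0] xs_nth[of "n - l"]
        by (simp_all add: hd_conv_nth[OF ne_xs] last_conv_nth[OF ne_xs])
      have "?pos u < n" if "u \<in> set (butlast xs)" for u
      proof -
        from that obtain i where "i < length (butlast xs)" "butlast xs ! i = u"
          by (meson in_set_conv_nth)
        then have i: "i < n - l" "u = zs ! (l + i)"
          using len xs_nth[of i] by (simp_all add: nth_butlast)
        then have "?pos u \<le> l + i"
          using first_index_le[of "l + i" zs] less.prems(1) by simp
        then show ?thesis using i(1) by simp
      qed
      moreover have "?pos u \<le> l" if "?pos u < n" for u
        using lmax[OF that] nth(2)[of u] late[of u] that less.prems(1)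
        by (cases "u < 2 ^ k") auto
      ultimately have "potential k (zs ! n) \<le> potential k (zs ! l) + walk_cost w xs"
        using ne_xs xs l less.prems V[of l] V[of n]
        by (intro potential_step) auto
      also have "potential k (zs ! l) \<le> walk_cost w (take (Suc l) zs)"
        using less.IH[of l] l less.prems(1) by simp
      also have "walk_cost w (take (Suc l) zs) + walk_cost w xs = walk_cost w (take (Suc n) zs)"
      proof -
        have "take (Suc l) zs = take l zs @ [zs ! l]"
          using l(1) less.prems(1) by (simp add: take_Suc_conv_app_nth)
        moreover obtain ys where ys: "xs = zs ! l # ys"
          using ne_xs xs(1) by (cases xs) auto
        moreover have "take (Suc n) zs = take l zs @ xs"
          using l(1) take_add[of l "Suc n - l" zs] by (simp add: xs_def)
        ultimately show ?thesis
          using walk_cost_append[of w "take l zs" "zs ! l" ys] by simp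
      qed
      finally show ?thesis by simp
    qed
  qed
  \<comment> \<open>\<open>m\<close> is the time of the last discovery; the rest of the walk only
    adds nonnegative cost.\<close>
  define m where "m = Max (?pos ` {..<2 ^ k})"
  have "m \<in> ?pos ` {..<2 ^ k}"
    unfolding m_def using ne by (intro Max_in) (simp_all flip: zs)
  then obtain a where a: "a < 2 ^ k" "m = ?pos a" by auto
  have amax: "?pos u \<le> ?pos a" if "u < 2 ^ k" for u
    unfolding a(2)[symmetric] m_def using that by (intro Max_ge) auto
  have s: "zs ! 0 < 2 ^ k" "?pos (zs ! 0) = 0"
    using V[of 0] first_index_le[of 0 zs] ne by simp_all
  have "\<alpha> * (real k * 2 ^ k) = potential k a"
    using potential_end[OF s amax] by simp
  also have "\<dots> \<le> walk_cost w (take (Suc (?pos a)) zs)"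
    using prefix[of "?pos a"] nth[OF a(1)] by simp
  also have "\<dots> \<le> walk_cost w zs"
  proof -
    have "take (Suc (?pos a)) zs = take (?pos a) zs @ [a]"
      using nth[OF a(1)] by (simp add: take_Suc_conv_app_nth)
    moreover have "zs = take (?pos a) zs @ a # drop (Suc (?pos a)) zs"
      using nth[OF a(1)] id_take_nth_drop by metis
    ultimately show ?thesis
      using walk_cost_append[of w "take (?pos a) zs" a "drop (Suc (?pos a)) zs"] cost_nonneg
      by (metis le_add_same_cancel1)
  qed
  finally show ?thesis .
qed

theorem theorem1:
  fixes \<alpha> c :: real and A :: "nat strategy"
  assumes "1 \<le> \<alpha>" and "\<alpha> \<le> 2"
    and "c < \<alpha>"
    and "geewe_algorithm A"
  shows "\<exists>P w xs. geewe_instance P w \<and>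
           (\<forall>e\<in>edges P. upper P e \<le> \<alpha> * lower P e) \<and>
           produces A P w xs \<and> walk_cost w xs > c * opt_cost P w"
proof -
  \<comment> \<open>For such \<open>k\<close> the additive 5 in the bound on the optimum is
    harmless. The absolute value covers negative \<open>c\<close>, and the summand 1 ensures
    \<open>1 \<le> k\<close>.\<close>
  obtain k :: nat where k: "5 * \<bar>c\<bar> / (\<alpha> - c) + 1 < real k"
    using reals_Archimedean2 by blast
  have "0 \<le> 5 * \<bar>c\<bar> / (\<alpha> - c)"
    using assms(3) by simp
  with k have k1: "1 \<le> k" by linarith
  have "5 * \<bar>c\<bar> / (\<alpha> - c) < real k" using k by simp
  then have "5 * \<bar>c\<bar> < (\<alpha> - c) * real k"
    using assms(3) by (simp add: pos_divide_less_eq mult.commute)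
  moreover have "c \<le> \<bar>c\<bar>" by simp
  ultimately have ratio: "c * (real k + 5) < \<alpha> * real k"
    by (simp add: algebra_simps)
  let ?P = "cluster_instance \<alpha> k"
  obtain zs where zs: "produces A ?P (weight \<alpha> (first_index zs)) zs" "exploration_walk ?P zs"
    using adversarial_run[OF assms(4,1,2) k1] by blast
  interpret adversary \<alpha> "first_index zs"
    using assms(1,2) by (rule adversary_first_index)
  have inst: "geewe_instance ?P w" by (rule instance_valid[OF k1])
  obtain os where os: "walk_cost w os = opt_cost ?P w"
    "\<And>ys. exploration_walk ?P ys \<Longrightarrow> walk_cost w os \<le> walk_cost w ys"
    using opt_cost_attained[OF inst] by blast
  have opt: "opt_cost ?P w \<le> (real k + 5) * 2 ^ k"
    using cheap_exploration[OF k1] os by (metis order_trans)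
  have opt0: "0 \<le> opt_cost ?P w"
    using cost_nonneg[of os] os(1) by simp
  have "set zs = {..<2 ^ k}" using zs(2) by (simp add: exploration_walk_def)
  then have cost: "\<alpha> * (real k * 2 ^ k) \<le> walk_cost w zs"
    by (rule adversarial_cost[OF assms(1,2)])
  have "c * opt_cost ?P w < \<alpha> * (real k * 2 ^ k)"
  \<comment> \<open>The upper bound on the optimum can be scaled by \<open>c\<close> only if
    \<open>c\<close> is nonnegative.\<close>
  proof (cases "0 \<le> c")
    case True
    then have "c * opt_cost ?P w \<le> (c * (real k + 5)) * 2 ^ k"
      using mult_left_mono[OF opt True] by (simp add: mult.assoc)
    also have "\<dots> < (\<alpha> * real k) * 2 ^ k"
      using ratio by (intro mult_strict_right_mono) auto
    finally show ?thesis by (simp add: mult.assoc)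
  next
    case False
    then have "c * opt_cost ?P w \<le> 0"
      using opt0 by (simp add: mult_nonpos_nonneg)
    also have "0 < \<alpha> * (real k * 2 ^ k)"
      using assms(1) k1 by simp
    finally show ?thesis .
  qed
  then have "c * opt_cost ?P w < walk_cost w zs" using cost by linarith
  moreover have "\<forall>e\<in>edges ?P. upper ?P e \<le> \<alpha> * lower ?P e" by simp
  ultimately show ?thesis using inst zs(1) by blast
qed

end
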